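(* Let $g$ be an analytic function on $[-1,1]$. Then there exist constants $\rho>1$ and $M(\rho)$, depending only on $g$, such that the following holds. Let $A\in\mathbb{C}^{n\times n}$ be a Hermitian matrix with spectrum inside $[-1,1]$, with eigenvalues $\lambda_1\le\dots\le\lambda_n$, and let $v_1\in\mathbb{R}^n$ be a unit vector with equal weights in all eigenvectors of $A$. Let $m\ge 1$ be such that the Lanczos process for $A$ started at $v_1$ runs for $m$ steps, and let $\phi$ and $\tilde\phi_{v_1}=\sum_{i=1}^m a_i\,\delta(t-\theta_i)$ be, respectively, the spectral density of $A$ and its $m$-term Lanczos approximation. Then $$\left|\langle \phi,g\rangle-\langle\tilde\phi_{v_1},g\rangle\right|\le \frac{4\rho^2M(\rho)}{(\rho^2-1)\,\rho^{2m}}.$$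
   Context: The spectral density (density of states) of $A$ is the distribution $\phi(t)=\frac1n\sum_{j=1}^n\delta(t-\lambda_j)$, where $\delta$ is the Dirac distribution, so $\langle\phi,g\rangle=\frac1n\sum_{j=1}^n g(\lambda_j)$. "Equal weights in all eigenvectors" means: there is an orthonormal basis $u_1,\dots,u_n$ of eigenvectors of $A$ such that $v_1=\sum_{i=1}^n\omega_iu_i$ with $|\omega_i|^2=1/n$ for all $i$. Lanczos process (exact arithmetic): with $v_0=0$, $\beta_1=0$, for $j=1,\dots,m$ set $w=Av_j-\beta_jv_{j-1}$, $\alpha_j=(w,v_j)$, $w\leftarrow w-\alpha_jv_j$, $\beta_{j+1}=\|w\|_2$, and $v_{j+1}=w/\beta_{j+1}$. Running for $m$ steps means that $v_1,\dots,v_m$ are well defined (i.e. $\beta_2,\dots,\beta_m\neq0$); then $v_1,\dots,v_m$ form an orthonormal basis of $\mathrm{span}\{v_1,Av_1,\dots,A^{m-1}v_1\}$. $T_m$ is the $m\times m$ real symmetric tridiagonal matrix with diagonal entries $\alpha_1,\dots,\alpha_m$ and off-diagonal entries $\beta_2,\dots,\beta_m$. Let $\theta_1,\dots,\theta_m$ be the eigenvalues of $T_m$ with corresponding orthonormal eigenvectors $y_1,\dots,y_m$, and put $a_i=(e_1^Ty_i)^2$, where $e_1$ is the first canonical basis vector of $\mathbb{R}^m$. The $m$-term Lanczos approximation is $\tilde\phi_{v_1}=\sum_{i=1}^m a_i\,\delta(t-\theta_i)$, so $\langle\tilde\phi_{v_1},g\rangle=\sum_{i=1}^m a_ig(\theta_i)$.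 *)

theory Defs
  imports "Jordan_Normal_Form.Spectral_Radius"
begin

text \<open>Local convergence of a Taylor series at every point of \<open>S\<close>. The neighbourhoods are relative to
  \<open>S\<close>, so the values of \<open>f\<close> outside \<open>S\<close> are irrelevant. Real-valued functions are covered through
  the embedding of the reals into the complex numbers.\<close>

definition real_analytic_on :: "(real \<Rightarrow> complex) \<Rightarrow> real set \<Rightarrow> bool" where
  "real_analytic_on f S \<longleftrightarrow>
     (\<forall>s\<in>S. \<exists>r>0. \<exists>a :: nat \<Rightarrow> complex.
        \<forall>x\<in>S. \<bar>x - s\<bar> < r \<longrightarrow> (\<lambda>k. a k * complex_of_real (x - s) ^ k) sums f x)"

definition hermitian :: "complex mat \<Rightarrow> bool" where
  "hermitian A \<longleftrightarrow> mat_adjoint A = A"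

definition norm2 :: "complex vec \<Rightarrow> real" where
  "norm2 v = sqrt (\<Sum>i<dim_vec v. (cmod (v $ i))\<^sup>2)"

definition equal_weights :: "nat \<Rightarrow> complex mat \<Rightarrow> complex vec \<Rightarrow> bool" where
  "equal_weights n A v \<longleftrightarrow>
     (\<exists>(u :: nat \<Rightarrow> complex vec) (\<omega> :: nat \<Rightarrow> complex).
        (\<forall>i<n. u i \<in> carrier_vec n \<and> (\<exists>\<mu>. eigenvector A (u i) \<mu>)) \<and>
        (\<forall>i<n. \<forall>j<n. u i \<bullet>c u j = (if i = j then 1 else 0)) \<and>
        v = finsum_vec TYPE(complex) n (\<lambda>i. \<omega> i \<cdot>\<^sub>v u i) {..<n} \<and>
        (\<forall>i<n. (cmod (\<omega> i))\<^sup>2 = 1 / real n))"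

text \<open>\<open>lanczos A v\<^sub>1 j\<close> is the pair \<open>(v\<^sub>j, \<beta>\<^sub>j)\<close>; its value at \<open>j = 0\<close> only supplies \<open>v\<^sub>0 = 0\<close>.
  The recursion is total because division by zero yields zero. After a breakdown its values are
  meaningless, which \<open>lanczos_runs\<close> rules out.\<close>

fun lanczos :: "complex mat \<Rightarrow> complex vec \<Rightarrow> nat \<Rightarrow> complex vec \<times> real" where
  "lanczos A v1 0 = (0\<^sub>v (dim_vec v1), 0)"
| "lanczos A v1 (Suc 0) = (v1, 0)"
| "lanczos A v1 (Suc (Suc j)) =
     (let vp = fst (lanczos A v1 j);
          v = fst (lanczos A v1 (Suc j));
          b = snd (lanczos A v1 (Suc j));
          w = A *\<^sub>v v - complex_of_real b \<cdot>\<^sub>v vp;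
          w' = w - (w \<bullet>c v) \<cdot>\<^sub>v v;
          b' = norm2 w'
      in (complex_of_real (1 / b') \<cdot>\<^sub>v w', b'))"

definition lanczos_vec :: "complex mat \<Rightarrow> complex vec \<Rightarrow> nat \<Rightarrow> complex vec" where
  "lanczos_vec A v1 j = fst (lanczos A v1 j)"

definition lanczos_beta :: "complex mat \<Rightarrow> complex vec \<Rightarrow> nat \<Rightarrow> real" where
  "lanczos_beta A v1 j = snd (lanczos A v1 j)"

definition lanczos_alpha :: "complex mat \<Rightarrow> complex vec \<Rightarrow> nat \<Rightarrow> complex" where
  "lanczos_alpha A v1 j =
     (A *\<^sub>v lanczos_vec A v1 j
        - complex_of_real (lanczos_beta A v1 j) \<cdot>\<^sub>v lanczos_vec A v1 (j - 1))
       \<bullet>c lanczos_vec A v1 j"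

definition lanczos_runs :: "complex mat \<Rightarrow> complex vec \<Rightarrow> nat \<Rightarrow> bool" where
  "lanczos_runs A v1 m \<longleftrightarrow> (\<forall>j\<in>{2..m}. lanczos_beta A v1 j \<noteq> 0)"

text \<open>Matrix indices start at \<open>0\<close>, those of \<open>\<alpha>\<close> and \<open>\<beta>\<close> at \<open>1\<close>. For Hermitian \<open>A\<close> the \<open>\<alpha>\<^sub>j\<close> are
  real, and \<open>Re\<close> is then only a change of type.\<close>

definition lanczos_matrix :: "complex mat \<Rightarrow> complex vec \<Rightarrow> nat \<Rightarrow> real mat" where
  "lanczos_matrix A v1 m = mat m m (\<lambda>(i, j).
     if i = j then Re (lanczos_alpha A v1 (i + 1))
     else if j = i + 1 then lanczos_beta A v1 (j + 1)
     else if i = j + 1 then lanczos_beta A v1 (i + 1)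
     else 0)"

definition orthonormal_eigensystem ::
    "nat \<Rightarrow> real mat \<Rightarrow> (nat \<Rightarrow> real) \<Rightarrow> (nat \<Rightarrow> real vec) \<Rightarrow> bool" where
  "orthonormal_eigensystem m T \<theta> y \<longleftrightarrow>
     (\<forall>i<m. y i \<in> carrier_vec m \<and> eigenvector T (y i) (\<theta> i)) \<and>
     (\<forall>i<m. \<forall>j<m. y i \<bullet> y j = (if i = j then 1 else 0))"

text \<open>Distributions are represented by their pairing with test functions:
  \<open>\<langle>\<phi>, g\<rangle>\<close> is the application \<open>\<phi> g\<close>.\<close>

definition dirac :: "real \<Rightarrow> (real \<Rightarrow> complex) \<Rightarrow> complex" where
  "dirac x g = g x"

definition spectral_density :: "real list \<Rightarrow> (real \<Rightarrow> complex) \<Rightarrow> complex" where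
  "spectral_density ls g = (1 / of_nat (length ls)) * (\<Sum>l\<leftarrow>ls. dirac l g)"

definition lanczos_density ::
    "nat \<Rightarrow> (nat \<Rightarrow> real) \<Rightarrow> (nat \<Rightarrow> real vec) \<Rightarrow> (real \<Rightarrow> complex) \<Rightarrow> complex" where
  "lanczos_density m \<theta> y g =
     (\<Sum>i<m. complex_of_real ((unit_vec m 0 \<bullet> y i)\<^sup>2) * dirac (\<theta> i) g)"

end

theory Submission
  imports Defs
begin

text \<open>In eigenvector coordinates the Lanczos vectors are values of polynomials orthonormal for the
  uniform mean over the eigenvalues of \<open>A\<close>. The Lanczos density is the associated Gauss quadrature,
  exact up to degree \<open>2m - 1\<close>, so the error is at most twice the distance of \<open>g\<close> to polynomials of
  that degree. That this distance decays geometrically is proved without complex analysis: truncated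
  power series approximate \<open>g\<close> locally, and neighbouring approximants are blended by a binomial tail
  polynomial, which is exponentially close to a step function and so beats the geometric growth of
  each approximant outside its own interval.\<close>

section \<open>Geometric polynomial approximation of analytic functions\<close>

text \<open>Analyticity is given on the real interval only, so no Bernstein ellipse is at hand from
  which to read off \<rho> and \<open>M\<close>. The invariant \<open>geometric_approx\<close>
  carries a degree factor \<open>L\<close>, a growth rate \<open>K\<close> and a decay rate
  \<open>q\<close>; gluing may worsen all of them, but finitely many gluings suffice. As the degree
  is \<open>L * N\<close> and not \<open>N\<close>, the final \<rho> is a root of
  \<open>1 / q\<close>. The factor in front of \<open>1 / \<rho> ^ (2 * m)\<close> depends on
  \<open>g\<close> alone, so \<open>M\<close> can absorb every constant. On the algebraic side,
  approximation on \<open>[-1, 1]\<close> helps only if the Ritz values lie there too, and the given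
  list of eigenvalues has to be matched, with multiplicities, to the eigenbasis supplied by the
  equal weights. The process may break down right after step \<open>m\<close>, so no argument may
  rely on \<open>\<beta> (m + 1) \<noteq> 0\<close>; hence the unnormalised residual
  polynomials.\<close>

lemma exp_le_quadratic:
  fixes h :: real
  assumes "\<bar>h\<bar> \<le> 1"
  shows "exp h \<le> 1 + h + h\<^sup>2"
proof (cases "h \<ge> 0")
  case True
  then show ?thesis using exp_bound[of h] assms by simp
next
  case False
  \<comment> \<open>For negative \<open>h\<close> both sides are compared after multiplication by
    \<open>1 - h > 0\<close>.\<close>
  have "(1 - h) * exp h \<le> exp (- h) * exp h"
    using exp_ge_add_one_self[of "- h"] by (intro mult_right_mono) auto
  then have "(1 - h) * exp h \<le> 1"
    by (simp flip: exp_add)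
  also have "1 \<le> 1 - h ^ 3"
    using False by (simp add: power3_eq_cube mult_nonneg_nonpos2 zero_le_mult_iff mult_le_0_iff)
  also have "\<dots> = (1 - h) * (1 + h + h\<^sup>2)"
    by (simp add: algebra_simps power2_eq_square power3_eq_cube)
  finally show ?thesis
    using False by (simp add: mult_le_cancel_left_pos)
qed

text \<open>Chernoff bound for success probability \<open>u\<close>: on \<open>S\<close> the weight
  \<open>exp (h * (k - t * N))\<close> is at least 1, and its mean is the \<open>N\<close>-th power
  of a one-trial mean. The sign condition puts \<open>S\<close> on the far side of
  \<open>t * N\<close>, seen from \<open>u * N\<close>, so both tails are covered at once.\<close>

lemma binomial_tail_le:
  fixes u t :: real
  assumes u: "0 \<le> u" "u \<le> 1" and t: "0 \<le> t" "t \<le> 1"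
    and S: "S \<subseteq> {..N}" "\<And>k. k \<in> S \<Longrightarrow> (t - u) * (real k - t * real N) \<ge> 0"
  shows "(\<Sum>k\<in>S. real (N choose k) * u ^ k * (1 - u) ^ (N - k)) \<le> exp (- (t - u)\<^sup>2 / 4) ^ N"
proof -
  \<comment> \<open>\<open>h\<close> minimises the final exponent per trial,
    \<open>h\<^sup>2 - (t - u) * h\<close>.\<close>
  define h where "h = (t - u) / 2"
  have h1: "\<bar>h\<bar> \<le> 1"
    using u t by (auto simp: h_def abs_if)
  have "(\<Sum>k\<in>S. real (N choose k) * u ^ k * (1 - u) ^ (N - k))
      \<le> (\<Sum>k\<in>S. real (N choose k) * u ^ k * (1 - u) ^ (N - k) * exp (h * (real k - t * real N)))"
  proof (rule sum_mono)
    fix k assume k: "k \<in> S"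
    have "h * (real k - t * real N) \<ge> 0"
      using S(2)[OF k] by (simp add: h_def)
    then have "real (N choose k) * u ^ k * (1 - u) ^ (N - k) * 1
        \<le> real (N choose k) * u ^ k * (1 - u) ^ (N - k) * exp (h * (real k - t * real N))"
      using u by (intro mult_left_mono) auto
    then show "real (N choose k) * u ^ k * (1 - u) ^ (N - k)
        \<le> real (N choose k) * u ^ k * (1 - u) ^ (N - k) * exp (h * (real k - t * real N))"
      by simp
  qed
  also have "\<dots> \<le> (\<Sum>k\<le>N. real (N choose k) * u ^ k * (1 - u) ^ (N - k) * exp (h * (real k - t * real N)))"
    using u S(1) by (intro sum_mono2) auto
  also have "\<dots> = (\<Sum>k\<le>N. real (N choose k) * (u * exp h) ^ k * (1 - u) ^ (N - k)) * exp (- h * t) ^ N"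
    unfolding sum_distrib_right
  proof (rule sum.cong)
    fix k
    have "exp (h * (real k - t * real N)) = exp h ^ k * exp (- h * t) ^ N"
    proof -
      have "h * (real k - t * real N) = real k * h + real N * (- h * t)"
        by (simp add: algebra_simps)
      then show ?thesis
        by (simp only: exp_add exp_of_nat_mult)
    qed
    then show "real (N choose k) * u ^ k * (1 - u) ^ (N - k) * exp (h * (real k - t * real N))
        = real (N choose k) * (u * exp h) ^ k * (1 - u) ^ (N - k) * exp (- h * t) ^ N"
      by (simp add: power_mult_distrib)
  qed simp
  also have "\<dots> = ((u * exp h + (1 - u)) * exp (- h * t)) ^ N"
    by (simp add: binomial_ring power_mult_distrib)
  also have "\<dots> \<le> exp (- (t - u)\<^sup>2 / 4) ^ N"
  proof (rule power_mono)
    have "u * exp h + (1 - u) = 1 + u * (exp h - 1)"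
      by (simp add: algebra_simps)
    also have "\<dots> \<le> exp (u * (exp h - 1))"
      by (rule exp_ge_add_one_self)
    also have "\<dots> \<le> exp (u * h + h\<^sup>2)"
    proof -
      have "u * (exp h - 1) \<le> u * (h + h\<^sup>2)"
        using exp_le_quadratic[OF h1] u by (intro mult_left_mono) auto
      also have "\<dots> \<le> u * h + h\<^sup>2"
        using mult_right_mono[OF u(2), of "h\<^sup>2"] by (simp add: distrib_left)
      finally show ?thesis by simp
    qed
    finally have "(u * exp h + (1 - u)) * exp (- h * t) \<le> exp (u * h + h\<^sup>2) * exp (- h * t)"
      by (rule mult_right_mono) simp
    also have "\<dots> = exp (- (t - u)\<^sup>2 / 4)"
    proof -
      have "u * h + h\<^sup>2 + - h * t = - (t - u)\<^sup>2 / 4"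
        by (simp add: h_def power2_eq_square field_simps)
      then show ?thesis
        by (simp only: flip: exp_add)
    qed
    finally show "(u * exp h + (1 - u)) * exp (- h * t) \<le> exp (- (t - u)\<^sup>2 / 4)" .
    show "0 \<le> (u * exp h + (1 - u)) * exp (- h * t)"
      using u by simp
  qed
  finally show ?thesis .
qed

text \<open>\<open>c\<close> is the Bernstein polynomial of the step function dropping from 1 to 0
  at \<open>t\<close>, moved from \<open>[0, 1]\<close> to \<open>[-1, 1]\<close>. Its values are
  binomial probabilities, and its deviations from 1 and 0 are binomial tails. \<open>s\<close> is
  the same polynomial with complex coefficients, ready to multiply approximants.\<close>

lemma cutoff_polynomial:
  fixes t :: real
  assumes t: "-1 \<le> t" "t \<le> 1"
  obtains s :: "complex poly" and c :: "real \<Rightarrow> real" where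
    "degree s \<le> N"
    "\<And>x. poly s (complex_of_real x) = complex_of_real (c x)"
    "\<And>x. -1 \<le> x \<Longrightarrow> x \<le> 1 \<Longrightarrow> 0 \<le> c x \<and> c x \<le> 1"
    "\<And>x. -1 \<le> x \<Longrightarrow> x \<le> t \<Longrightarrow> 1 - c x \<le> exp (- (t - x)\<^sup>2 / 16) ^ N"
    "\<And>x. t \<le> x \<Longrightarrow> x \<le> 1 \<Longrightarrow> c x \<le> exp (- (t - x)\<^sup>2 / 16) ^ N"
proof -
  define t' where "t' = (1 + t) / 2"
  define S where "S = {k. k \<le> N \<and> real k \<le> t' * real N}"
  define b where "b k u = real (N choose k) * u ^ k * (1 - u) ^ (N - k)" for k and u :: real
  define s :: "complex poly" where
    "s = (\<Sum>k\<in>S. Polynomial.smult (of_nat (N choose k)) ([:1/2, 1/2:] ^ k * [:1/2, -1/2:] ^ (N - k)))"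
  define c where "c x = (\<Sum>k\<in>S. b k ((1 + x) / 2))" for x
  have S: "S \<subseteq> {..N}" "finite S"
    by (auto simp: S_def)
  have t': "0 \<le> t'" "t' \<le> 1"
    using t by (auto simp: t'_def)
  have compl: "1 - c x = (\<Sum>k\<in>{..N} - S. b k ((1 + x) / 2))" for x
  proof -
    have "(\<Sum>k\<le>N. b k ((1 + x) / 2)) = ((1 + x) / 2 + (1 - (1 + x) / 2)) ^ N"
      by (simp only: b_def binomial_ring)
    also have "\<dots> = 1"
      by simp
    finally show ?thesis
      using S by (simp add: c_def sum_diff)
  qed
  have b_nonneg: "0 \<le> b k ((1 + x) / 2)" if "-1 \<le> x" "x \<le> 1" for k x
    using that by (simp add: b_def)
  \<comment> \<open>The affine map halves distances, which turns the exponent 1/4 into 1/16.\<close>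
  have sq: "(t' - (1 + x) / 2)\<^sup>2 / 4 = (t - x)\<^sup>2 / 16" for x
    by (simp add: t'_def power2_eq_square field_simps)
  show thesis
  proof (rule that[of s c])
    show "degree s \<le> N"
      unfolding s_def
    proof (rule degree_sum_le[OF S(2)])
      fix k assume "k \<in> S"
      then have "k \<le> N" by (simp add: S_def)
      have "degree (([:1/2, 1/2:] :: complex poly) ^ k * [:1/2, -1/2:] ^ (N - k))
          \<le> degree (([:1/2, 1/2:] :: complex poly) ^ k) + degree (([:1/2, -1/2:] :: complex poly) ^ (N - k))"
        by (rule degree_mult_le)
      also have "\<dots> \<le> 1 * k + 1 * (N - k)"
        by (intro add_mono order.trans[OF degree_power_le]) auto
      finally show "degree (Polynomial.smult (of_nat (N choose k)) (([:1/2, 1/2:] :: complex poly) ^ k * [:1/2, -1/2:] ^ (N - k))) \<le> N"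
        using \<open>k \<le> N\<close> by (intro order.trans[OF degree_smult_le]) simp
    qed
    show "poly s (complex_of_real x) = complex_of_real (c x)" for x
    proof -
      have "1 / 2 + complex_of_real x * (1 / 2) = of_real ((1 + x) / 2)"
        "1 / 2 + complex_of_real x * (- 1 / 2) = of_real (1 - (1 + x) / 2)"
        by (simp_all add: field_simps)
      then have "poly [:1/2, 1/2:] (complex_of_real x) = of_real ((1 + x) / 2)"
        "poly [:1/2, -1/2:] (complex_of_real x) = of_real (1 - (1 + x) / 2)"
        by simp_all
      then show ?thesis
        unfolding s_def c_def b_def poly_sum poly_smult poly_mult poly_power of_real_sum
        by (simp only: of_real_mult of_real_power of_real_of_nat_eq mult.assoc)
    qed
    show "0 \<le> c x \<and> c x \<le> 1" if "-1 \<le> x" "x \<le> 1" for x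
    proof -
      have "0 \<le> c x" "0 \<le> 1 - c x"
        unfolding compl unfolding c_def using b_nonneg[OF that] by (auto intro: sum_nonneg)
      then show ?thesis by simp
    qed
    show "1 - c x \<le> exp (- (t - x)\<^sup>2 / 16) ^ N" if x: "-1 \<le> x" "x \<le> t" for x
    proof -
      have "1 - c x \<le> exp (- (t' - (1 + x) / 2)\<^sup>2 / 4) ^ N"
        unfolding compl b_def
        using x t t' by (intro binomial_tail_le) (auto simp: S_def t'_def)
      then show ?thesis using sq[of x] by simp
    qed
    show "c x \<le> exp (- (t - x)\<^sup>2 / 16) ^ N" if x: "t \<le> x" "x \<le> 1" for x
    proof -
      have "c x \<le> exp (- (t' - (1 + x) / 2)\<^sup>2 / 4) ^ N"
        unfolding c_def b_def
        using x t t' by (intro binomial_tail_le) (auto simp: S_def t'_def intro!: mult_nonpos_nonpos)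
      then show ?thesis using sq[of x] by simp
    qed
  qed
qed

text \<open>The bound on all of \<open>[-1, 1]\<close> controls the approximants outside \<open>S\<close>, where a cutoff
  polynomial then suppresses them.\<close>

definition geometric_approx :: "(real \<Rightarrow> complex) \<Rightarrow> real set \<Rightarrow> bool" where
  "geometric_approx g S \<longleftrightarrow>
     (\<exists>(L :: nat) C K q. 0 \<le> C \<and> 1 \<le> K \<and> 0 \<le> q \<and> q < 1 \<and>
       (\<forall>N. \<exists>p. degree p \<le> L * N \<and>
         (\<forall>x\<in>{-1..1}. cmod (poly p (complex_of_real x)) \<le> C * K ^ N) \<and>
         (\<forall>x\<in>S. cmod (g x - poly p (complex_of_real x)) \<le> C * q ^ N)))"

section \<open>Gluing of geometric approximations\<close>

lemma geometric_approx_subset: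
  assumes "geometric_approx g S" "S' \<subseteq> S"
  shows "geometric_approx g S'"
  using assms unfolding geometric_approx_def by (meson subsetD)

text \<open>In the form \<open>(z - w1) + (1 - c) * (w1 - w2)\<close> only \<open>w1\<close> has to
  be close to \<open>z\<close>; \<open>w2\<close> need only obey the growth bound, which the small
  factor \<open>1 - c\<close> absorbs. The other side of the cutoff follows by swapping
  \<open>w1\<close>, \<open>w2\<close> and \<open>c\<close>, \<open>1 - c\<close>.\<close>

lemma cutoff_error:
  fixes z w1 w2 :: complex
  assumes c: "0 \<le> c" "1 - c \<le> d" "c \<le> 1" and K: "1 \<le> K" "0 \<le> C"
    and q: "0 \<le> q" "q \<le> 1" "q \<le> r" and d: "d * K ^ N \<le> r ^ N"
    and w: "cmod (z - w1) \<le> C * q ^ N" "cmod w1 \<le> C * K ^ N" "cmod w2 \<le> C * K ^ N"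
  shows "cmod (z - (of_real c * w1 + of_real (1 - c) * w2)) \<le> 3 * C * r ^ N"
proof -
  have "z - (of_real c * w1 + of_real (1 - c) * w2) = (z - w1) + of_real (1 - c) * (w1 - w2)"
    by (simp add: algebra_simps)
  also have "cmod \<dots> \<le> cmod (z - w1) + cmod (of_real (1 - c) * (w1 - w2))"
    by (rule norm_triangle_ineq)
  also have "cmod (of_real (1 - c) * (w1 - w2)) = (1 - c) * cmod (w1 - w2)"
    using c unfolding norm_mult norm_of_real by simp
  also have "\<dots> \<le> d * (2 * (C * K ^ N))"
  proof (rule mult_mono)
    show "cmod (w1 - w2) \<le> 2 * (C * K ^ N)"
      using norm_triangle_ineq4[of w1 w2] w by linarith
  qed (use c in auto)
  also have "\<dots> = 2 * C * (d * K ^ N)"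
    by simp
  also have "\<dots> \<le> 2 * C * r ^ N"
    using d K by (intro mult_left_mono) auto
  also have "cmod (z - w1) \<le> C * r ^ N"
    using w(1) power_mono[OF q(3,1), of N] K by (meson mult_left_mono order.trans)
  finally show ?thesis by simp
qed

text \<open>At distance at least \<open>e\<close> from \<open>t\<close> the cutoff suppresses the
  wrong approximant. Closer to \<open>t\<close> it is not sharp, but there both approximants are
  good and so is any convex combination; this is why the two sets must overlap.\<close>

lemma geometric_approx_glue:
  assumes g1: "geometric_approx g S1" and g2: "geometric_approx g S2"
    and t: "-1 \<le> t" "t \<le> 1" and e: "0 < e"
    and S: "S \<subseteq> {-1..1}"
      "\<And>x. x \<in> S \<Longrightarrow> x \<le> t + e \<Longrightarrow> x \<in> S1" "\<And>x. x \<in> S \<Longrightarrow> t - e \<le> x \<Longrightarrow> x \<in> S2"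
  shows "geometric_approx g S"
proof -
  obtain L1 :: nat and C1 K1 q1 where 1: "0 \<le> C1" "1 \<le> K1" "0 \<le> q1" "q1 < 1"
    "\<And>N. \<exists>p. degree p \<le> L1 * N \<and> (\<forall>x\<in>{-1..1}. cmod (poly p (complex_of_real x)) \<le> C1 * K1 ^ N) \<and>
         (\<forall>x\<in>S1. cmod (g x - poly p (complex_of_real x)) \<le> C1 * q1 ^ N)"
    using g1 unfolding geometric_approx_def by blast
  obtain L2 :: nat and C2 K2 q2 where 2: "0 \<le> C2" "1 \<le> K2" "0 \<le> q2" "q2 < 1"
    "\<And>N. \<exists>p. degree p \<le> L2 * N \<and> (\<forall>x\<in>{-1..1}. cmod (poly p (complex_of_real x)) \<le> C2 * K2 ^ N) \<and>
         (\<forall>x\<in>S2. cmod (g x - poly p (complex_of_real x)) \<le> C2 * q2 ^ N)"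
    using g2 unfolding geometric_approx_def by blast
  define C K q where "C = max C1 C2" and "K = max K1 K2" and "q = max q1 q2"
  \<comment> \<open>The bound 1/2 keeps the target rate positive even if
    \<open>q = 0\<close>.\<close>
  define r where "r = max q (1 / 2)"
  have C: "0 \<le> C" "C1 \<le> C" "C2 \<le> C" and K: "1 \<le> K" "K1 \<le> K" "K2 \<le> K"
    and q: "0 \<le> q" "q < 1" "q1 \<le> q" "q2 \<le> q" and r: "q \<le> r" "0 \<le> r" "r < 1" "1 / 2 \<le> r"
    using 1 2 by (auto simp: C_def K_def q_def r_def)
  have mono: "C1 * K1 ^ N \<le> C * K ^ N" "C2 * K2 ^ N \<le> C * K ^ N"
    "C1 * q1 ^ N \<le> C * q ^ N" "C2 * q2 ^ N \<le> C * q ^ N" for N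
    using 1 2 C K q by (auto intro!: mult_mono power_mono)
  define \<sigma> where "\<sigma> = exp (- e\<^sup>2 / 16)"
  have \<sigma>: "0 \<le> \<sigma>" "\<sigma> < 1"
    using e by (auto simp: \<sigma>_def)
  \<comment> \<open>A cutoff of degree \<open>R * N\<close> has error
    \<open>(\<sigma> ^ R) ^ N\<close>, small enough to outweigh the growth
    \<open>K ^ N\<close>.\<close>
  obtain R where "\<sigma> ^ R < 1 / (2 * K)"
    using real_arch_pow_inv[of "1 / (2 * K)" \<sigma>] \<sigma> K by auto
  then have R: "\<sigma> ^ R * K \<le> r"
    using r(4) K by (simp add: field_simps)
  have cut: "\<sigma> ^ (R * N) * K ^ N \<le> r ^ N" for N
  proof -
    have "(\<sigma> ^ R * K) ^ N \<le> r ^ N"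
      using \<sigma> K by (intro power_mono[OF R]) auto
    then show ?thesis by (simp add: power_mult power_mult_distrib)
  qed
  have "\<exists>p. degree p \<le> (R + L1 + L2) * N \<and>
         (\<forall>x\<in>{-1..1}. cmod (poly p (complex_of_real x)) \<le> (3 * C) * K ^ N) \<and>
         (\<forall>x\<in>S. cmod (g x - poly p (complex_of_real x)) \<le> (3 * C) * r ^ N)" for N
  proof -
    obtain p1 where p1: "degree p1 \<le> L1 * N"
      "\<And>x. x \<in> {-1..1} \<Longrightarrow> cmod (poly p1 (complex_of_real x)) \<le> C1 * K1 ^ N"
      "\<And>x. x \<in> S1 \<Longrightarrow> cmod (g x - poly p1 (complex_of_real x)) \<le> C1 * q1 ^ N"
      using 1(5)[of N] by blast
    obtain p2 where p2: "degree p2 \<le> L2 * N"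
      "\<And>x. x \<in> {-1..1} \<Longrightarrow> cmod (poly p2 (complex_of_real x)) \<le> C2 * K2 ^ N"
      "\<And>x. x \<in> S2 \<Longrightarrow> cmod (g x - poly p2 (complex_of_real x)) \<le> C2 * q2 ^ N"
      using 2(5)[of N] by blast
    note bd1 = order.trans[OF p1(2) mono(1)] and bd2 = order.trans[OF p2(2) mono(2)]
    note er1 = order.trans[OF p1(3) mono(3)] and er2 = order.trans[OF p2(3) mono(4)]
    obtain s c where s: "degree s \<le> R * N"
      "\<And>x. poly s (complex_of_real x) = complex_of_real (c x)"
      "\<And>x. -1 \<le> x \<Longrightarrow> x \<le> 1 \<Longrightarrow> 0 \<le> c x \<and> c x \<le> 1"
      "\<And>x. -1 \<le> x \<Longrightarrow> x \<le> t \<Longrightarrow> 1 - c x \<le> exp (- (t - x)\<^sup>2 / 16) ^ (R * N)"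
      "\<And>x. t \<le> x \<Longrightarrow> x \<le> 1 \<Longrightarrow> c x \<le> exp (- (t - x)\<^sup>2 / 16) ^ (R * N)"
      using cutoff_polynomial[OF t, of "R * N"] by blast
    have far: "exp (- (t - x)\<^sup>2 / 16) ^ (R * N) \<le> \<sigma> ^ (R * N)" if "e \<le> \<bar>t - x\<bar>" for x
    proof -
      have "e\<^sup>2 \<le> (t - x)\<^sup>2"
        using that e by (metis abs_le_square_iff abs_of_pos)
      then show ?thesis
        unfolding \<sigma>_def by (intro power_mono) auto
    qed
    define p where "p = s * p1 + (1 - s) * p2"
    have p: "poly p (complex_of_real x) = of_real (c x) * poly p1 (of_real x) + of_real (1 - c x) * poly p2 (of_real x)" for x
      by (simp add: p_def s(2))
    have deg: "degree p \<le> (R + L1 + L2) * N"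
    proof -
      have "degree (1 - s) \<le> R * N"
        using degree_diff_le[of 1 "R * N" s] s(1) by simp
      then show ?thesis
        unfolding p_def using s(1) p1(1) p2(1)
        by (intro degree_add_le order.trans[OF degree_mult_le]) (simp_all add: algebra_simps)
    qed
    have bound: "cmod (poly p (complex_of_real x)) \<le> (3 * C) * K ^ N" if x: "x \<in> {-1..1}" for x
    proof -
      have "cmod (poly p (complex_of_real x)) \<le> \<bar>c x\<bar> * cmod (poly p1 (of_real x)) + \<bar>1 - c x\<bar> * cmod (poly p2 (of_real x))"
        unfolding p by (rule order.trans[OF norm_triangle_ineq]) (simp only: norm_mult norm_of_real order_refl)
      also have "\<dots> \<le> 1 * (C * K ^ N) + 1 * (C * K ^ N)"
        using s(3)[of x] x bd1[OF x] bd2[OF x] by (intro add_mono mult_mono) auto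
      also have "\<dots> \<le> (3 * C) * K ^ N"
        using C(1) K(1) by simp
      finally show ?thesis .
    qed
    have error: "cmod (g x - poly p (complex_of_real x)) \<le> (3 * C) * r ^ N" if x: "x \<in> S" for x
    proof -
      have xI: "x \<in> {-1..1}"
        using x S(1) by auto
      consider "x \<le> t - e" | "t + e \<le> x" | "x \<le> t + e" "t - e \<le> x"
        by linarith
      then show ?thesis
      proof cases
        case 1
        have "1 - c x \<le> \<sigma> ^ (R * N)"
          using s(4)[of x] far[of x] 1 e xI by fastforce
        then show ?thesis
          unfolding p using s(3)[of x] xI K C q r cut[of N] er1[OF S(2)[OF x]] bd1[OF xI] bd2[OF xI] 1 e
          by (intro cutoff_error[where q = q and K = K and d = "\<sigma> ^ (R * N)"]) auto
      next
        case 2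
        have "c x \<le> \<sigma> ^ (R * N)"
          using s(5)[of x] far[of x] 2 e xI by fastforce
        then have "cmod (g x - (of_real (1 - c x) * poly p2 (of_real x) + of_real (1 - (1 - c x)) * poly p1 (of_real x))) \<le> 3 * C * r ^ N"
          using s(3)[of x] xI K C q r cut[of N] er2[OF S(3)[OF x]] bd1[OF xI] bd2[OF xI] 2 e
          by (intro cutoff_error[where q = q and K = K and d = "\<sigma> ^ (R * N)"]) auto
        then show ?thesis
          unfolding p by (simp add: add.commute)
      next
        case 3
        have "g x - poly p (of_real x) = of_real (c x) * (g x - poly p1 (of_real x)) + of_real (1 - c x) * (g x - poly p2 (of_real x))"
          unfolding p by (simp add: algebra_simps)
        also have "cmod \<dots> \<le> \<bar>c x\<bar> * cmod (g x - poly p1 (of_real x)) + \<bar>1 - c x\<bar> * cmod (g x - poly p2 (of_real x))"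
          by (rule order.trans[OF norm_triangle_ineq]) (simp only: norm_mult norm_of_real order_refl)
        also have "\<dots> \<le> \<bar>c x\<bar> * (C * q ^ N) + \<bar>1 - c x\<bar> * (C * q ^ N)"
          using er1[OF S(2)[OF x]] er2[OF S(3)[OF x]] 3 by (intro add_mono mult_left_mono) auto
        also have "\<dots> = C * q ^ N"
          using s(3)[of x] xI by (simp add: algebra_simps)
        also have "\<dots> \<le> (3 * C) * r ^ N"
          using C q r by (intro mult_mono power_mono) auto
        finally show ?thesis .
      qed
    qed
    show ?thesis
      using deg bound error by blast
  qed
  moreover have "0 \<le> 3 * C" using C by simp
  ultimately show ?thesis
    unfolding geometric_approx_def using K(1) r(2,3) by blast
qed

section \<open>Local approximants and the passage to the whole interval\<close>

text \<open>Abel's argument: the terms are bounded at one point at distance \<open>r'\<close> from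
  \<open>s\<close>, hence decay like \<open>(1 / 2) ^ k\<close> within half that distance; on all of
  \<open>[-1, 1]\<close>, of length 2, they grow at most like \<open>(2 / r') ^ k\<close>.\<close>

lemma geometric_approx_power_series:
  assumes s: "s \<in> {-1..1}" and r: "0 < r"
    and sums: "\<And>x. x \<in> {-1..1} \<Longrightarrow> \<bar>x - s\<bar> < r \<Longrightarrow> (\<lambda>k. a k * complex_of_real (x - s) ^ k) sums g x"
  obtains d where "0 < d" "geometric_approx g ({-1..1} \<inter> {s - d..s + d})"
proof -
  \<comment> \<open>\<open>r' \<le> 1\<close> puts \<open>s + r'\<close> or \<open>s - r'\<close>
    into \<open>[-1, 1]\<close>, where alone the series is known to converge.\<close>
  define r' where "r' = min (r / 2) 1"
  have r': "0 < r'" "r' < r" "r' \<le> 1"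
    using r by (auto simp: r'_def)
  define x1 where "x1 = (if s \<le> 0 then s + r' else s - r')"
  have x1: "x1 \<in> {-1..1}" "\<bar>x1 - s\<bar> = r'"
    using s r' by (auto simp: x1_def)
  have "summable (\<lambda>k. a k * complex_of_real (x1 - s) ^ k)"
    using sums[of x1] x1 r' by (auto simp: sums_iff)
  then have "Bseq (\<lambda>k. a k * complex_of_real (x1 - s) ^ k)"
    by (intro convergent_imp_Bseq) (auto simp: convergent_def dest: summable_LIMSEQ_zero)
  then obtain B where B: "0 < B" "\<And>k. cmod (a k * complex_of_real (x1 - s) ^ k) \<le> B"
    by (auto simp: Bseq_def)
  have aB: "cmod (a k) * r' ^ k \<le> B" for k
    using B(2)[of k] x1 by (simp add: norm_mult norm_power del: of_real_diff)
  \<comment> \<open>The summand 2 gives \<open>K - 1 \<ge> 1\<close>, so that the geometric sum is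
    at most \<open>K ^ N\<close>.\<close>
  define K where "K = 2 / r' + 2"
  have K: "2 \<le> K" "2 / r' \<le> K"
    using r' by (auto simp: K_def)
  define p where "p N = (\<Sum>k<N. Polynomial.smult (a k) ([:- complex_of_real s, 1:] ^ k))" for N
  have p: "poly (p N) (complex_of_real x) = (\<Sum>k<N. a k * complex_of_real (x - s) ^ k)" for N x
    by (simp add: p_def poly_sum)
  have "degree (p N) \<le> 1 * N" for N
    unfolding p_def
  proof (rule degree_sum_le)
    fix k assume "k \<in> {..<N}"
    then show "degree (Polynomial.smult (a k) ([:- complex_of_real s, 1:] ^ k)) \<le> 1 * N"
      by (intro order.trans[OF degree_smult_le] order.trans[OF degree_power_le]) auto
  qed simp
  moreover have "cmod (poly (p N) (complex_of_real x)) \<le> (2 * B) * K ^ N" if "x \<in> {-1..1}" for x N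
  proof -
    have "cmod (poly (p N) (complex_of_real x)) \<le> (\<Sum>k<N. B * K ^ k)"
      unfolding p
    proof (rule sum_norm_le)
      fix k
      have "\<bar>x - s\<bar> \<le> 2"
        using that s by auto
      then have "cmod (a k * complex_of_real (x - s) ^ k) \<le> cmod (a k) * 2 ^ k"
        by (simp add: norm_mult norm_power del: of_real_diff) (intro mult_left_mono power_mono; simp)
      also have "\<dots> = (cmod (a k) * r' ^ k) * (2 / r') ^ k"
        using r' by (simp add: power_divide)
      also have "\<dots> \<le> B * K ^ k"
        using aB K r' B by (intro mult_mono power_mono) auto
      finally show "cmod (a k * complex_of_real (x - s) ^ k) \<le> B * K ^ k" .
    qed
    also have "\<dots> = B * (\<Sum>k<N. K ^ k)"
      by (simp add: sum_distrib_left)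
    also have "(\<Sum>k<N. K ^ k) \<le> K ^ N"
    proof -
      have "(K - 1) * (\<Sum>k<N. K ^ k) = K ^ N - 1"
        by (simp add: power_diff_1_eq)
      moreover have "1 * (\<Sum>k<N. K ^ k) \<le> (K - 1) * (\<Sum>k<N. K ^ k)"
        using K by (intro mult_right_mono sum_nonneg) auto
      ultimately show ?thesis by simp
    qed
    also have "B * K ^ N \<le> (2 * B) * K ^ N"
      using B K by simp
    finally show ?thesis using B by simp
  qed
  moreover have "cmod (g x - poly (p N) (complex_of_real x)) \<le> (2 * B) * (1 / 2) ^ N"
    if x: "x \<in> {-1..1} \<inter> {s - r' / 2..s + r' / 2}" for x N
  proof -
    let ?f = "\<lambda>k. a k * complex_of_real (x - s) ^ k"
    have xs: "\<bar>x - s\<bar> \<le> r' / 2"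
      using x by (auto simp: abs_if)
    have f: "?f sums g x"
      using x xs r' by (intro sums) auto
    have tail: "(\<lambda>k. ?f (k + N)) sums (g x - poly (p N) (complex_of_real x))"
      unfolding p using sums_split_initial_segment[OF f] .
    have geo: "(\<lambda>k. B * (1 / 2) ^ N * (1 / 2) ^ k) sums (B * (1 / 2) ^ N * 2)"
      using sums_mult[OF geometric_sums[of "1 / 2 :: real"], of "B * (1 / 2) ^ N"] by simp
    have le: "cmod (?f (k + N)) \<le> B * (1 / 2) ^ N * (1 / 2) ^ k" for k
    proof -
      have "cmod (?f (k + N)) \<le> cmod (a (k + N)) * (r' / 2) ^ (k + N)"
        using xs by (simp add: norm_mult norm_power del: of_real_diff power_add) (intro mult_left_mono power_mono; simp)
      also have "\<dots> = (cmod (a (k + N)) * r' ^ (k + N)) * (1 / 2) ^ (k + N)"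
        by (simp add: power_divide)
      also have "\<dots> \<le> B * (1 / 2) ^ (k + N)"
        using aB by (intro mult_right_mono) auto
      finally show ?thesis by (simp add: power_add algebra_simps)
    qed
    have "cmod (g x - poly (p N) (complex_of_real x)) \<le> B * (1 / 2) ^ N * 2"
      using norm_suminf_le[of "\<lambda>k. ?f (k + N)", OF le] tail geo by (simp add: sums_iff)
    then show ?thesis by (simp add: mult_ac)
  qed
  ultimately have "geometric_approx g ({-1..1} \<inter> {s - r' / 2..s + r' / 2})"
    unfolding geometric_approx_def using B K
    by (intro exI[of _ "1::nat"] exI[of _ "2 * B"] exI[of _ K] exI[of _ "1 / 2 :: real"] conjI allI exI[of _ "p _"]) auto
  then show thesis
    using that[of "r' / 2"] r' by simp
qed

text \<open>Compactness by interval subdivision. \<open>P\<close> demands a margin beyond both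
  endpoints, so that adjacent intervals overlap as gluing requires.\<close>

theorem geometric_approx_real_analytic:
  assumes "real_analytic_on g {-1..1}"
  shows "geometric_approx g {-1..1}"
proof -
  define P where "P a b \<longleftrightarrow> (-1 \<le> a \<and> b \<le> 1 \<longrightarrow>
    (\<exists>d>0. geometric_approx g ({-1..1} \<inter> {a - d..b + d})))" for a b :: real
  have "P (-1) 1"
  proof (rule Bolzano)
    fix a b c :: real
    assume ab: "P a b" and bc: "P b c" and le: "a \<le> b" "b \<le> c"
    show "P a c"
      unfolding P_def
    proof
      assume *: "-1 \<le> a \<and> c \<le> 1"
      obtain d1 where d1: "d1 > 0" "geometric_approx g ({-1..1} \<inter> {a - d1..b + d1})"
        using ab * le unfolding P_def by auto
      obtain d2 where d2: "d2 > 0" "geometric_approx g ({-1..1} \<inter> {b - d2..c + d2})"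
        using bc * le unfolding P_def by auto
      have "geometric_approx g ({-1..1} \<inter> {a - min d1 d2..c + min d1 d2})"
        by (rule geometric_approx_glue[OF d1(2) d2(2), of b "min d1 d2"]) (use * le d1 d2 in auto)
      then show "\<exists>d>0. geometric_approx g ({-1..1} \<inter> {a - d..c + d})"
        using d1 d2 by (intro exI[of _ "min d1 d2"]) auto
    qed
  next
    fix x :: real
    assume x: "-1 \<le> x" "x \<le> 1"
    then obtain r a where "r > 0"
      "\<forall>y\<in>{-1..1}. \<bar>y - x\<bar> < r \<longrightarrow> (\<lambda>k. a k * complex_of_real (y - x) ^ k) sums g y"
      using assms unfolding real_analytic_on_def by (metis atLeastAtMost_iff)
    then obtain d where d: "0 < d" "geometric_approx g ({-1..1} \<inter> {x - d..x + d})"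
      using geometric_approx_power_series[of x r a g] x by auto
    have "P a b" if "a \<le> x \<and> x \<le> b \<and> b - a < d / 2" for a b
      unfolding P_def
      using that d by (intro impI exI[of _ "d / 2"] conjI geometric_approx_subset[OF d(2)]) auto
    then show "\<exists>d>0. \<forall>a b. a \<le> x \<and> x \<le> b \<and> b - a < d \<longrightarrow> P a b"
      using d(1) by (intro exI[of _ "d / 2"]) auto
  qed simp
  then show ?thesis
    unfolding P_def by (auto intro: geometric_approx_subset)
qed

section \<open>Orthogonal polynomials and Gauss quadrature\<close>

text \<open>A one-sided inverse of a square matrix is two-sided. Keeping \<open>h\<close> apart from
  \<open>f\<close> allows it to be the complex conjugate.\<close>

lemma transpose_orthonormal:
  fixes f h :: "nat \<Rightarrow> nat \<Rightarrow> 'a :: field"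
  assumes "\<And>i j. i < n \<Longrightarrow> j < n \<Longrightarrow> (\<Sum>a<n. f i a * h j a) = (if i = j then 1 else 0)"
    and "a < n" "b < n"
  shows "(\<Sum>i<n. h i a * f i b) = (if a = b then 1 else 0)"
proof -
  define F where "F = mat n n (\<lambda>(i, a). f i a)"
  define H where "H = mat n n (\<lambda>(a, i). h i a)"
  have "F * H = 1\<^sub>m n"
  proof (rule eq_matI)
    fix i j assume "i < dim_row (1\<^sub>m n :: 'a mat)" "j < dim_col (1\<^sub>m n :: 'a mat)"
    then have ij: "i < n" "j < n" by auto
    then have "(F * H) $$ (i, j) = (\<Sum>a<n. f i a * h j a)"
      by (simp add: F_def H_def scalar_prod_def atLeast0LessThan)
    also have "\<dots> = (if i = j then 1 else 0)"
      by (rule assms(1)[OF ij])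
    finally show "(F * H) $$ (i, j) = 1\<^sub>m n $$ (i, j)"
      using ij by simp
  qed (simp_all add: F_def H_def)
  moreover have "F \<in> carrier_mat n n" "H \<in> carrier_mat n n"
    by (simp_all add: F_def H_def)
  ultimately have HF: "H * F = 1\<^sub>m n"
    using mat_mult_left_right_inverse by blast
  have "(\<Sum>i<n. h i a * f i b) = (H * F) $$ (a, b)"
    using assms(2,3) by (simp add: F_def H_def scalar_prod_def atLeast0LessThan)
  also have "\<dots> = (if a = b then 1 else 0)"
    unfolding HF using assms(2,3) by simp
  finally show ?thesis .
qed

text \<open>The recurrence of the Lanczos vectors with \<open>A\<close> replaced by the variable.
  Numbering starts at 1, so member \<open>j\<close> has degree \<open>j - 1\<close>; member 0
  mirrors the zero vector.\<close>

fun lanczos_poly :: "(nat \<Rightarrow> real) \<Rightarrow> (nat \<Rightarrow> real) \<Rightarrow> nat \<Rightarrow> real poly" where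
  "lanczos_poly \<alpha> \<beta> 0 = 0"
| "lanczos_poly \<alpha> \<beta> (Suc 0) = 1"
| "lanczos_poly \<alpha> \<beta> (Suc (Suc j)) = Polynomial.smult (1 / \<beta> (Suc (Suc j)))
     ([:- \<alpha> (Suc j), 1:] * lanczos_poly \<alpha> \<beta> (Suc j) - Polynomial.smult (\<beta> (Suc j)) (lanczos_poly \<alpha> \<beta> j))"

text \<open>The next polynomial before normalisation. At \<open>j = m\<close> it is still meaningful
  when \<open>\<beta> (m + 1) = 0\<close>.\<close>

definition lanczos_residual :: "(nat \<Rightarrow> real) \<Rightarrow> (nat \<Rightarrow> real) \<Rightarrow> nat \<Rightarrow> real poly" where
  "lanczos_residual \<alpha> \<beta> j =
     [:- \<alpha> j, 1:] * lanczos_poly \<alpha> \<beta> j - Polynomial.smult (\<beta> j) (lanczos_poly \<alpha> \<beta> (j - 1))"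

lemma lanczos_poly_Suc:
  "1 \<le> j \<Longrightarrow> lanczos_poly \<alpha> \<beta> (Suc j) = Polynomial.smult (1 / \<beta> (Suc j)) (lanczos_residual \<alpha> \<beta> j)"
  unfolding lanczos_residual_def by (cases j) (simp_all only: lanczos_poly.simps diff_Suc_1 not_one_le_zero)

lemma residual_eq_smult:
  "1 \<le> j \<Longrightarrow> \<beta> (Suc j) \<noteq> 0 \<Longrightarrow>
    lanczos_residual \<alpha> \<beta> j = Polynomial.smult (\<beta> (Suc j)) (lanczos_poly \<alpha> \<beta> (Suc j))"
  by (simp only: lanczos_poly_Suc smult_smult) simp

lemma shift_lanczos_poly:
  "pCons 0 (lanczos_poly \<alpha> \<beta> j) = lanczos_residual \<alpha> \<beta> j + Polynomial.smult (\<alpha> j) (lanczos_poly \<alpha> \<beta> j)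
     + Polynomial.smult (\<beta> j) (lanczos_poly \<alpha> \<beta> (j - 1))"
  by (simp add: lanczos_residual_def)

lemma degree_lanczos:
  assumes "\<And>j. 2 \<le> j \<Longrightarrow> j \<le> m \<Longrightarrow> \<beta> j \<noteq> 0" "1 \<le> j" "j \<le> m"
  shows "lanczos_poly \<alpha> \<beta> j \<noteq> 0 \<and> degree (lanczos_poly \<alpha> \<beta> j) = j - 1 \<and> degree (lanczos_residual \<alpha> \<beta> j) = j"
  using assms(2,3)
proof (induction j rule: less_induct)
  case (less j)
  have res: "degree (lanczos_residual \<alpha> \<beta> j) = j"
    if P: "lanczos_poly \<alpha> \<beta> j \<noteq> 0" "degree (lanczos_poly \<alpha> \<beta> j) = j - 1"
  proof -
    have "degree ([:- \<alpha> j, 1:] * lanczos_poly \<alpha> \<beta> j) = j"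
      using P less.prems by (simp add: degree_mult_eq del: mult_pCons_left)
    moreover have "degree (Polynomial.smult (\<beta> j) (lanczos_poly \<alpha> \<beta> (j - 1))) < j"
    proof (cases "j = 1")
      case False
      then have "degree (lanczos_poly \<alpha> \<beta> (j - 1)) < j"
        using less.IH[of "j - 1"] less.prems by auto
      then show ?thesis
        by (rule le_less_trans[OF degree_smult_le])
    qed simp
    ultimately show ?thesis
      unfolding lanczos_residual_def
      by (metis degree_add_eq_left degree_minus diff_conv_add_uminus)
  qed
  show ?case
  proof (cases "j = 1")
    case True
    then show ?thesis using res by simp
  next
    case False
    then obtain i where i: "j = Suc i" "1 \<le> i"
      using less.prems by (cases j) auto
    have IH: "degree (lanczos_residual \<alpha> \<beta> i) = i"
      using less.IH[of i] less.prems i by auto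
    have b: "\<beta> (Suc i) \<noteq> 0"
      using assms(1)[of j] i less.prems by auto
    have "degree (lanczos_poly \<alpha> \<beta> j) = i"
      using IH b by (simp only: i(1) lanczos_poly_Suc[OF i(2)] degree_smult_eq) simp
    moreover have "lanczos_poly \<alpha> \<beta> j \<noteq> 0"
      using calculation i(2) by auto
    ultimately show ?thesis using res i by simp
  qed
qed

section \<open>Orthogonality for a linear functional on polynomials\<close>

locale poly_functional =
  fixes L :: "real poly \<Rightarrow> real"
  assumes add: "L (p + q) = L p + L q"
    and smult: "L (Polynomial.smult c p) = c * L p"
begin

lemma zero: "L 0 = 0"
  using smult[of 0 0] by simp

lemma diff: "L (p - q) = L p - L q"
  using add[of p "- q"] smult[of "-1" q] by simp

text \<open>Polynomials with one member of each degree below \<open>N\<close> span that space; the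
  induction strips leading terms.\<close>

lemma eq_zero_graded:
  assumes b: "\<And>k. k < N \<Longrightarrow> b k \<noteq> 0 \<and> degree (b k) = k \<and> L (b k) = 0"
    and p: "degree p < N"
  shows "L p = 0"
proof -
  have "L p = 0" if "k \<le> N" "\<And>i. i \<ge> k \<Longrightarrow> coeff p i = 0" for k p
    using that
  proof (induction k arbitrary: p)
    case 0
    then have "p = 0" by (intro poly_eqI) auto
    then show ?case by (simp add: zero)
  next
    case (Suc k)
    define c where "c = coeff p k / lead_coeff (b k)"
    have bk: "b k \<noteq> 0" "degree (b k) = k" "L (b k) = 0"
      using b[of k] Suc.prems by auto
    have "L (p - Polynomial.smult c (b k)) = 0"
    proof (rule Suc.IH)
      fix i assume "k \<le> i"
      show "coeff (p - Polynomial.smult c (b k)) i = 0"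
      proof (cases "i = k")
        case True
        moreover have "coeff (b k) k \<noteq> 0"
          using bk by (metis leading_coeff_0_iff)
        ultimately show ?thesis using bk by (simp add: c_def)
      next
        case False
        then show ?thesis
          using \<open>k \<le> i\<close> Suc.prems(2)[of i] bk by (simp add: coeff_eq_0)
      qed
    qed (use Suc.prems in auto)
    then show ?case
      by (simp add: diff smult bk)
  qed
  from this[of N p] show ?thesis
    using p by (auto simp: coeff_eq_0)
qed

end

text \<open>Stieltjes' procedure in axiomatic form: the coefficients are those that orthonormalise
  the powers of the variable for \<open>L\<close>. The condition \<open>j < m\<close> in
  \<open>beta\<close> stops the normalisation at \<open>\<beta> m\<close>.\<close>

locale lanczos_functional = poly_functional +
  fixes \<alpha> \<beta> :: "nat \<Rightarrow> real" and m :: nat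
  assumes one: "L 1 = 1"
    and m: "1 \<le> m"
    and beta_1: "\<beta> 1 = 0"
    and beta_nonzero: "2 \<le> j \<Longrightarrow> j \<le> m \<Longrightarrow> \<beta> j \<noteq> 0"
    and alpha: "1 \<le> j \<Longrightarrow> j \<le> m \<Longrightarrow> \<alpha> j =
      L ((pCons 0 (lanczos_poly \<alpha> \<beta> j) - Polynomial.smult (\<beta> j) (lanczos_poly \<alpha> \<beta> (j - 1))) * lanczos_poly \<alpha> \<beta> j)"
    and beta: "1 \<le> j \<Longrightarrow> j < m \<Longrightarrow> (\<beta> (Suc j))\<^sup>2 = L ((lanczos_residual \<alpha> \<beta> j)\<^sup>2)"
begin

abbreviation "P \<equiv> lanczos_poly \<alpha> \<beta>"
abbreviation "res \<equiv> lanczos_residual \<alpha> \<beta>"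

text \<open>For \<open>k = j\<close> this is the choice of \<alpha>. For \<open>k < j\<close> the
  variable moves over to \<open>P k\<close>, whose recurrence can meet \<open>P j\<close> only
  through \<open>P (k + 1)\<close>; if \<open>k + 1 = j\<close>, that term cancels the \<beta>
  term.\<close>

lemma residual_orthogonal_aux:
  assumes orth: "\<And>i k. 1 \<le> i \<Longrightarrow> i \<le> j \<Longrightarrow> 1 \<le> k \<Longrightarrow> k \<le> j \<Longrightarrow> L (P i * P k) = (if i = k then 1 else 0)"
    and j: "1 \<le> j" "j \<le> m" and k: "1 \<le> k" "k \<le> j"
  shows "L (res j * P k) = 0"
proof (cases "k = j")
  case True
  have "res j = (pCons 0 (P j) - Polynomial.smult (\<beta> j) (P (j - 1))) - Polynomial.smult (\<alpha> j) (P j)"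
    by (simp add: lanczos_residual_def)
  then have "L (res j * P j) = \<alpha> j - \<alpha> j * L (P j * P j)"
    using alpha[OF j] by (simp add: left_diff_distrib diff smult del: mult_pCons_left)
  then show ?thesis
    using orth[of j j] j True by simp
next
  case False
  then have kj: "k < j" using k by simp
  have shift: "L (pCons 0 (P j) * P k) = L (P j * pCons 0 (P k))"
    by simp
  have res_k: "res k = Polynomial.smult (\<beta> (Suc k)) (P (Suc k))"
    using k kj j beta_nonzero[of "Suc k"] by (intro residual_eq_smult) auto
  have prev: "\<beta> i * L (P l * P (i - 1)) = (if Suc l = i then \<beta> i else 0)"
    if "1 \<le> i" "i \<le> j" "1 \<le> l" "l \<le> j" for i l
    using orth[of l "i - 1"] that beta_1 by (cases "i = 1") auto
  have "L (P j * pCons 0 (P k)) = \<beta> (Suc k) * L (P j * P (Suc k)) + \<alpha> k * L (P j * P k) + \<beta> k * L (P j * P (k - 1))"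
    unfolding shift_lanczos_poly[of \<alpha> \<beta> k] res_k by (simp add: distrib_left add smult)
  also have "\<dots> = (if Suc k = j then \<beta> j else 0)"
    using orth[of j "Suc k"] orth[of j k] prev[of k j] kj k j by auto
  finally have *: "L (pCons 0 (P j) * P k) = (if Suc k = j then \<beta> j else 0)"
    using shift by simp
  have "res j = pCons 0 (P j) - Polynomial.smult (\<alpha> j) (P j) - Polynomial.smult (\<beta> j) (P (j - 1))"
    by (simp add: lanczos_residual_def)
  then have "L (res j * P k) = L (pCons 0 (P j) * P k) - \<alpha> j * L (P j * P k) - \<beta> j * L (P k * P (j - 1))"
    by (simp add: left_diff_distrib diff smult mult.commute[of "P k"] del: mult_pCons_left)
  then show ?thesis
    using * orth[of j k] prev[of j k] kj k j by auto
qed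

lemma orthonormal:
  assumes "1 \<le> i" "i \<le> m" "1 \<le> k" "k \<le> m"
  shows "L (P i * P k) = (if i = k then 1 else 0)"
proof -
  have "\<forall>i k. 1 \<le> i \<and> i \<le> j \<and> 1 \<le> k \<and> k \<le> j \<longrightarrow> L (P i * P k) = (if i = k then 1 else 0)"
    if "j \<le> m" for j
    using that
  proof (induction j)
    case 0
    then show ?case by simp
  next
    case (Suc j)
    show ?case
    proof (cases "j = 0")
      case True
      have "P i * P k = 1" if "i = 1" "k = 1" for i k
        using that by simp
      then show ?thesis
        using True one by (auto simp: le_Suc_eq)
    next
      case False
      then have j: "1 \<le> j" "j \<le> m" "j < m" using Suc.prems by auto
      have IH: "L (P i * P k) = (if i = k then 1 else 0)" if "1 \<le> i" "i \<le> j" "1 \<le> k" "k \<le> j" for i k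
        using Suc that by auto
      have b: "\<beta> (Suc j) \<noteq> 0"
        using beta_nonzero[of "Suc j"] j by auto
      have off: "L (P (Suc j) * P k) = 0" if "1 \<le> k" "k \<le> j" for k
        using residual_orthogonal_aux[OF IH j(1,2) that] j by (simp add: lanczos_poly_Suc smult)
      have diag: "L (P (Suc j) * P (Suc j)) = 1"
      proof -
        have "L (P (Suc j) * P (Suc j)) = (1 / \<beta> (Suc j)) * ((1 / \<beta> (Suc j)) * L (res j * res j))"
          by (simp only: lanczos_poly_Suc[OF j(1)] mult_smult_left mult_smult_right smult)
        also have "L (res j * res j) = (\<beta> (Suc j))\<^sup>2"
          using beta[OF j(1,3)] by (simp only: power2_eq_square)
        finally show ?thesis
          using b by (simp add: power2_eq_square)
      qed
      have off': "L (P k * P (Suc j)) = 0" if "1 \<le> k" "k \<le> j" for k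
        using off[OF that] by (simp only: mult.commute)
      show ?thesis
        using IH off off' diag by (auto simp: le_Suc_eq)
    qed
  qed
  from this[of m] show ?thesis
    using assms by auto
qed

lemma residual_orthogonal:
  assumes "1 \<le> k" "k \<le> m"
  shows "L (res m * P k) = 0"
  using residual_orthogonal_aux[of m k] orthonormal m assms by auto

lemmas degree_P = degree_lanczos[of m \<beta> _ \<alpha>, OF beta_nonzero]

text \<open>The polynomials \<open>P 1, \<dots>, P m, P 1 * res m, \<dots>, P m * res m\<close> have degrees \<open>0, \<dots>, 2m - 1\<close>, so a
  functional that satisfies the same orthogonality relations agrees with \<open>L\<close> up to degree \<open>2m - 1\<close>.\<close>

lemma gauss_exact:
  assumes Q: "poly_functional Q"
    and orth: "\<And>k. 1 \<le> k \<Longrightarrow> k \<le> m \<Longrightarrow> Q (P k) = (if k = 1 then 1 else 0)"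
    and res: "\<And>k. 1 \<le> k \<Longrightarrow> k \<le> m \<Longrightarrow> Q (res m * P k) = 0"
    and p: "degree p < 2 * m"
  shows "Q p = L p"
proof -
  interpret Q: poly_functional Q by (rule Q)
  interpret D: poly_functional "\<lambda>p. L p - Q p"
    by unfold_locales (simp_all add: add smult Q.add Q.smult algebra_simps)
  define b where "b k = (if k < m then P (Suc k) else res m * P (Suc (k - m)))" for k
  have rm: "res m \<noteq> 0" "degree (res m) = m"
    using degree_P[of m] m by auto
  have "L p - Q p = 0"
  proof (rule D.eq_zero_graded[where b = b and N = "2 * m"])
    fix k assume k: "k < 2 * m"
    show "b k \<noteq> 0 \<and> degree (b k) = k \<and> L (b k) - Q (b k) = 0"
    proof (cases "k < m")
      case True
      \<comment> \<open>\<open>P 1 = 1\<close>, so orthonormality against it yields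
        \<open>L (P (Suc k))\<close>.\<close>
      then show ?thesis
        using degree_P[of "Suc k"] orth[of "Suc k"] orthonormal[of "Suc k" 1] m by (auto simp: b_def)
    next
      case False
      then have "1 \<le> Suc (k - m)" "Suc (k - m) \<le> m" using k by auto
      then show ?thesis
        using degree_P[of "Suc (k - m)"] rm False residual_orthogonal[of "Suc (k - m)"] res[of "Suc (k - m)"]
        by (auto simp: b_def degree_mult_eq)
    qed
  qed (rule p)
  then show ?thesis by simp
qed

end

section \<open>Eigenvectors of the tridiagonal matrix and exactness of the quadrature\<close>

locale lanczos_ritz = lanczos_functional +
  fixes T :: "real mat" and \<theta> :: "nat \<Rightarrow> real" and y :: "nat \<Rightarrow> real Matrix.vec"
  assumes T_def: "T = mat m m (\<lambda>(i, j).
      if i = j then \<alpha> (i + 1) else if j = i + 1 then \<beta> (j + 1) else if i = j + 1 then \<beta> (i + 1) else 0)"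
    and eigensystem: "orthonormal_eigensystem m T \<theta> y"
begin

lemma y_carrier: "l < m \<Longrightarrow> y l \<in> carrier_vec m"
  using eigensystem by (auto simp: orthonormal_eigensystem_def)

lemma y_orthonormal:
  assumes "i < m" "j < m"
  shows "(\<Sum>a<m. y i $ a * y j $ a) = (if i = j then 1 else 0)"
proof -
  have "y i \<bullet> y j = (\<Sum>a<m. y i $ a * y j $ a)"
    using y_carrier[OF assms(2)] by (simp add: scalar_prod_def atLeast0LessThan)
  then show ?thesis
    using eigensystem assms by (simp add: orthonormal_eigensystem_def)
qed

text \<open>Numbered from 1 like \<alpha> and \<beta>, and padded with zeros so that the first and
  last rows of the eigenvalue equation look like all the others.\<close>

definition ritz_comp :: "nat \<Rightarrow> nat \<Rightarrow> real" where
  "ritz_comp l j = (if 1 \<le> j \<and> j \<le> m then y l $ (j - 1) else 0)"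

lemma ritz_comp_recurrence:
  assumes l: "l < m" and j: "1 \<le> j" "j \<le> m"
  shows "\<beta> j * ritz_comp l (j - 1) + \<alpha> j * ritz_comp l j + \<beta> (j + 1) * ritz_comp l (j + 1) = \<theta> l * ritz_comp l j"
proof -
  obtain i where i: "j = Suc i" "i < m"
    using j by (cases j) auto
  have "(\<theta> l \<cdot>\<^sub>v y l) $ i = (T *\<^sub>v y l) $ i"
    using eigensystem l by (simp add: orthonormal_eigensystem_def eigenvector_def)
  also have "\<dots> = (\<Sum>k<m. T $$ (i, k) * y l $ k)"
    using i y_carrier[OF l] by (simp add: T_def scalar_prod_def atLeast0LessThan)
  \<comment> \<open>For \<open>i = 0\<close> the index \<open>i - 1\<close> is 0 again; the inner
    conditional removes this spurious entry.\<close>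
  also have "\<dots> = (\<Sum>k<m. (if k = i then \<alpha> j * y l $ k else 0) + (if k = j then \<beta> (j + 1) * y l $ k else 0)
      + (if k = i - 1 then \<beta> j * (if i = 0 then 0 else y l $ k) else 0))"
    using i by (intro sum.cong) (auto simp: T_def)
  also have "\<dots> = \<alpha> j * ritz_comp l j + \<beta> (j + 1) * ritz_comp l (j + 1) + \<beta> j * ritz_comp l (j - 1)"
    using i by (auto simp: sum.distrib sum.delta ritz_comp_def)
  finally show ?thesis
    using y_carrier[OF l] i by (simp add: ritz_comp_def)
qed

text \<open>Row \<open>j\<close> solved for the next component. The residual form includes the last
  row, where that component is the padding zero.\<close>

lemma ritz_comp_residual:
  assumes l: "l < m" and j: "1 \<le> j" "j \<le> m"
    and c: "ritz_comp l j = ritz_comp l 1 * poly (P j) (\<theta> l)" "j \<noteq> 1 \<Longrightarrow> ritz_comp l (j - 1) = ritz_comp l 1 * poly (P (j - 1)) (\<theta> l)"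
  shows "ritz_comp l 1 * poly (res j) (\<theta> l) = \<beta> (j + 1) * ritz_comp l (j + 1)"
proof -
  have "\<beta> j * ritz_comp l (j - 1) = ritz_comp l 1 * (\<beta> j * poly (P (j - 1)) (\<theta> l))"
    using c(2) beta_1 by (cases "j = 1") auto
  moreover have "ritz_comp l 1 * poly (res j) (\<theta> l) =
      (\<theta> l - \<alpha> j) * (ritz_comp l 1 * poly (P j) (\<theta> l)) - ritz_comp l 1 * (\<beta> j * poly (P (j - 1)) (\<theta> l))"
    by (simp add: lanczos_residual_def algebra_simps)
  ultimately show ?thesis
    using ritz_comp_recurrence[OF l j] unfolding c(1)[symmetric] left_diff_distrib by linarith
qed

text \<open>The rows determine every component from the first, because the off-diagonal entries do
  not vanish.\<close>

lemma ritz_comp_eq_poly: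
  assumes l: "l < m" and j: "1 \<le> j" "j \<le> m"
  shows "ritz_comp l j = ritz_comp l 1 * poly (P j) (\<theta> l)"
  using j
proof (induction j rule: less_induct)
  case (less j)
  show ?case
  proof (cases "j = 1")
    case False
    then obtain i where i: "j = Suc i" "1 \<le> i" "i \<le> m"
      using less.prems by (cases j) auto
    have "ritz_comp l 1 * poly (res i) (\<theta> l) = \<beta> (i + 1) * ritz_comp l (i + 1)"
      using less.IH[of i] less.IH[of "i - 1"] i by (intro ritz_comp_residual l) auto
    moreover have "\<beta> (i + 1) \<noteq> 0"
      using beta_nonzero[of j] less.prems i by auto
    ultimately show ?thesis
      unfolding i(1) lanczos_poly_Suc[OF i(2)] by (simp add: field_simps)
  qed simp
qed

text \<open>The Ritz values are the Gauss nodes, the roots of \<open>res m\<close>. The first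
  component stays as a factor, since it enters the quadrature weight anyway.\<close>

lemma ritz_comp_residual_zero:
  assumes "l < m"
  shows "ritz_comp l 1 * poly (res m) (\<theta> l) = 0"
  using ritz_comp_residual[OF assms m order_refl ritz_comp_eq_poly[OF assms m order_refl] ritz_comp_eq_poly[OF assms]] m
  by (simp add: ritz_comp_def)

lemma ritz_comp_orthonormal:
  assumes "1 \<le> j" "j \<le> m" "1 \<le> k" "k \<le> m"
  shows "(\<Sum>l<m. ritz_comp l j * ritz_comp l k) = (if j = k then 1 else 0)"
  using transpose_orthonormal[of m "\<lambda>l a. y l $ a" "\<lambda>l a. y l $ a" "j - 1" "k - 1", OF y_orthonormal] assms
  by (auto simp: ritz_comp_def)

text \<open>With squared first components as weights, \<open>Q (P k)\<close> is the sum over all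
  eigenvectors of first times \<open>k\<close>-th component, so the transposed orthonormality
  applies; multiples of \<open>res m\<close> vanish at every node that carries weight.\<close>

lemma quadrature_exact:
  assumes "degree p < 2 * m"
  shows "(\<Sum>l<m. (y l $ 0)\<^sup>2 * poly p (\<theta> l)) = L p"
proof -
  define Q where "Q p = (\<Sum>l<m. (ritz_comp l 1)\<^sup>2 * poly p (\<theta> l))" for p
  have "Q p = L p"
  proof (rule gauss_exact[OF _ _ _ assms])
    show "poly_functional Q"
      by unfold_locales (simp_all add: Q_def algebra_simps sum.distrib sum_distrib_left)
    show "Q (P k) = (if k = 1 then 1 else 0)" if k: "1 \<le> k" "k \<le> m" for k
    proof -
      have "Q (P k) = (\<Sum>l<m. ritz_comp l k * ritz_comp l 1)"
        unfolding Q_def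
      proof (rule sum.cong)
        fix l assume "l \<in> {..<m}"
        then show "(ritz_comp l 1)\<^sup>2 * poly (P k) (\<theta> l) = ritz_comp l k * ritz_comp l 1"
          using ritz_comp_eq_poly[of l k] k by (simp add: power2_eq_square)
      qed simp
      then show ?thesis
        using ritz_comp_orthonormal[of k 1] k m by simp
    qed
    show "Q (res m * P k) = 0" for k
      unfolding Q_def
    proof (rule sum.neutral, rule)
      fix l assume "l \<in> {..<m}"
      then show "(ritz_comp l 1)\<^sup>2 * poly (res m * P k) (\<theta> l) = 0"
        using ritz_comp_residual_zero[of l] by (auto simp: power2_eq_square)
    qed
  qed
  then show ?thesis
    using m by (simp add: Q_def ritz_comp_def)
qed

text \<open>The polynomial of a Ritz vector: its coefficients in the basis \<open>P 1, \<dots>, P m\<close> are the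
  components of the eigenvector, which makes \<open>\<theta> l\<close> a Rayleigh quotient of \<open>L\<close>.\<close>

lemma ritz_value_rayleigh:
  assumes l: "l < m"
  obtains q where "L (q\<^sup>2) = 1" "L (pCons 0 (q\<^sup>2)) = \<theta> l"
proof -
  define q where "q = (\<Sum>a<m. Polynomial.smult (y l $ a) (P (Suc a)))"
  have "degree q \<le> m - 1"
    unfolding q_def
  proof (rule degree_sum_le)
    fix a assume "a \<in> {..<m}"
    then show "degree (Polynomial.smult (y l $ a) (P (Suc a))) \<le> m - 1"
      using degree_P[of "Suc a"] by (intro order.trans[OF degree_smult_le]) auto
  qed simp
  \<comment> \<open>Degree \<open>2 * m - 2\<close> leaves room for one more factor of the variable
    below \<open>2 * m\<close>.\<close>
  then have deg: "degree (q\<^sup>2) \<le> 2 * (m - 1)"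
    using degree_power_le[of q 2] by simp
  \<comment> \<open>Up to scaling, \<open>q\<close> acts as a Lagrange polynomial for node
    \<open>l\<close>, so the quadrature sums collapse to one term.\<close>
  have q: "y k $ 0 * poly q (\<theta> k) = (if k = l then 1 else 0)" if k: "k < m" for k
  proof -
    have "y k $ 0 * poly q (\<theta> k) = (\<Sum>a<m. y l $ a * (ritz_comp k 1 * poly (P (Suc a)) (\<theta> k)))"
      using m by (simp add: q_def poly_sum sum_distrib_left ritz_comp_def mult_ac)
    also have "\<dots> = (\<Sum>a<m. y l $ a * y k $ a)"
    proof (rule sum.cong)
      fix a assume a: "a \<in> {..<m}"
      then have "ritz_comp k 1 * poly (P (Suc a)) (\<theta> k) = ritz_comp k (Suc a)"
        using ritz_comp_eq_poly[OF k, of "Suc a"] by simp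
      also have "\<dots> = y k $ a"
        using a by (simp add: ritz_comp_def)
      finally show "y l $ a * (ritz_comp k 1 * poly (P (Suc a)) (\<theta> k)) = y l $ a * y k $ a"
        by simp
    qed simp
    finally show ?thesis
      using y_orthonormal[OF l k] by auto
  qed
  have sq: "(y k $ 0)\<^sup>2 * poly (q\<^sup>2) (\<theta> k) = (if k = l then 1 else 0)" if "k < m" for k
  proof -
    have "(y k $ 0)\<^sup>2 * poly (q\<^sup>2) (\<theta> k) = (y k $ 0 * poly q (\<theta> k))\<^sup>2"
      by (simp add: power_mult_distrib)
    then show ?thesis
      by (simp add: q[OF that])
  qed
  have "L (q\<^sup>2) = (\<Sum>k<m. (y k $ 0)\<^sup>2 * poly (q\<^sup>2) (\<theta> k))"
    using deg m by (intro quadrature_exact[symmetric]) linarith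
  also have "\<dots> = (\<Sum>k<m. if k = l then 1 else 0)"
    using sq by (intro sum.cong) auto
  finally have 1: "L (q\<^sup>2) = 1"
    using l by simp
  have "degree (pCons 0 (q\<^sup>2)) < 2 * m"
    using deg m degree_pCons_le[of 0 "q\<^sup>2"] by linarith
  then have "L (pCons 0 (q\<^sup>2)) = (\<Sum>k<m. (y k $ 0)\<^sup>2 * poly (pCons 0 (q\<^sup>2)) (\<theta> k))"
    by (rule quadrature_exact[symmetric])
  also have "\<dots> = (\<Sum>k<m. if k = l then \<theta> l else 0)"
  proof (rule sum.cong)
    fix k assume "k \<in> {..<m}"
    then have "\<theta> k * ((y k $ 0)\<^sup>2 * poly (q\<^sup>2) (\<theta> k)) = (if k = l then \<theta> l else 0)"
      using sq by simp
    then show "(y k $ 0)\<^sup>2 * poly (pCons 0 (q\<^sup>2)) (\<theta> k) = (if k = l then \<theta> l else 0)"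
      by (simp add: mult_ac)
  qed simp
  finally show thesis
    using that 1 l by simp
qed

end

section \<open>Lanczos vectors in eigenvector coordinates\<close>

lemma cscalar_prod_sum:
  "w \<in> carrier_vec n \<Longrightarrow> v \<bullet>c w = (\<Sum>a<n. v $ a * cnj (w $ a))"
  by (simp add: scalar_prod_def atLeast0LessThan conjugate_complex_def)

lemma hermitian_index:
  assumes "hermitian A" "A \<in> carrier_mat n n" "i < n" "j < n"
  shows "A $$ (i, j) = cnj (A $$ (j, i))"
proof -
  have "A $$ (i, j) = mat_adjoint A $$ (i, j)"
    using assms(1) by (simp add: hermitian_def)
  also have "\<dots> = cnj (A $$ (j, i))"
    using assms(2-) by (simp add: mat_adjoint_def mat_of_rows_def conjugate_complex_def)
  finally show ?thesis .
qed

locale orthonormal_eigenbasis =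
  fixes n :: nat and A :: "complex mat" and u :: "nat \<Rightarrow> complex Matrix.vec" and \<mu> :: "nat \<Rightarrow> real"
  assumes A: "A \<in> carrier_mat n n" "hermitian A"
    and u_carrier: "i < n \<Longrightarrow> u i \<in> carrier_vec n"
    and u_eigen: "i < n \<Longrightarrow> A *\<^sub>v u i = complex_of_real (\<mu> i) \<cdot>\<^sub>v u i"
    and u_orthonormal: "i < n \<Longrightarrow> j < n \<Longrightarrow> u i \<bullet>c u j = (if i = j then 1 else 0)"
begin

definition coord :: "nat \<Rightarrow> complex Matrix.vec \<Rightarrow> complex" where
  "coord i w = (\<Sum>a<n. w $ a * cnj (u i $ a))"

lemma coord_diff: "v \<in> carrier_vec n \<Longrightarrow> w \<in> carrier_vec n \<Longrightarrow> coord i (v - w) = coord i v - coord i w"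
  by (simp add: coord_def left_diff_distrib sum_subtractf)

lemma coord_smult: "v \<in> carrier_vec n \<Longrightarrow> coord i (c \<cdot>\<^sub>v v) = c * coord i v"
  by (simp add: coord_def sum_distrib_left mult.assoc)

text \<open>Hermitian symmetry moves \<open>A\<close> onto \<open>u i\<close>, and the eigenvalue,
  being real, survives conjugation.\<close>

lemma coord_mult_mat:
  assumes v: "v \<in> carrier_vec n" and i: "i < n"
  shows "coord i (A *\<^sub>v v) = of_real (\<mu> i) * coord i v"
proof -
  have "coord i (A *\<^sub>v v) = (\<Sum>a<n. \<Sum>b<n. A $$ (a, b) * v $ b * cnj (u i $ a))"
    using v A by (simp add: coord_def scalar_prod_def atLeast0LessThan sum_distrib_right)
  also have "\<dots> = (\<Sum>b<n. \<Sum>a<n. A $$ (a, b) * v $ b * cnj (u i $ a))"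
    by (rule sum.swap)
  also have "\<dots> = (\<Sum>b<n. v $ b * cnj ((A *\<^sub>v u i) $ b))"
  proof (rule sum.cong)
    fix b assume "b \<in> {..<n}"
    then have b: "b < n" by simp
    have "(\<Sum>a<n. A $$ (a, b) * v $ b * cnj (u i $ a)) = (\<Sum>a<n. v $ b * cnj (A $$ (b, a) * u i $ a))"
    proof (rule sum.cong)
      fix a assume "a \<in> {..<n}"
      then have "A $$ (a, b) = cnj (A $$ (b, a))"
        by (intro hermitian_index[OF A(2,1)] b) simp
      then show "A $$ (a, b) * v $ b * cnj (u i $ a) = v $ b * cnj (A $$ (b, a) * u i $ a)"
        by simp
    qed simp
    also have "\<dots> = v $ b * cnj ((A *\<^sub>v u i) $ b)"
      using A u_carrier[OF i] b by (simp add: scalar_prod_def atLeast0LessThan sum_distrib_left)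
    finally show "(\<Sum>a<n. A $$ (a, b) * v $ b * cnj (u i $ a)) = v $ b * cnj ((A *\<^sub>v u i) $ b)" .
  qed simp
  also have "\<dots> = of_real (\<mu> i) * coord i v"
    using u_carrier[OF i] by (simp add: u_eigen[OF i] coord_def sum_distrib_left mult_ac)
  finally show ?thesis .
qed

lemma u_orthonormal_sum:
  "i < n \<Longrightarrow> j < n \<Longrightarrow> (\<Sum>a<n. u i $ a * cnj (u j $ a)) = (if i = j then 1 else 0)"
  using u_orthonormal[of i j] cscalar_prod_sum[OF u_carrier, of j "u i"] by simp

lemma u_complete:
  assumes "a < n" "b < n"
  shows "(\<Sum>i<n. cnj (u i $ a) * u i $ b) = (if a = b then 1 else 0)"
  using transpose_orthonormal[of n "\<lambda>i a. u i $ a" "\<lambda>i a. cnj (u i $ a)", OF u_orthonormal_sum assms] .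

lemma parseval:
  assumes w: "w \<in> carrier_vec n"
  shows "v \<bullet>c w = (\<Sum>i<n. coord i v * cnj (coord i w))"
proof -
  have "(\<Sum>i<n. coord i v * cnj (coord i w))
      = (\<Sum>i<n. \<Sum>a<n. \<Sum>b<n. v $ a * cnj (w $ b) * (cnj (u i $ a) * u i $ b))"
    by (simp add: coord_def sum_product mult_ac)
  also have "\<dots> = (\<Sum>a<n. \<Sum>i<n. \<Sum>b<n. v $ a * cnj (w $ b) * (cnj (u i $ a) * u i $ b))"
    by (rule sum.swap)
  also have "\<dots> = (\<Sum>a<n. \<Sum>b<n. v $ a * cnj (w $ b) * (\<Sum>i<n. cnj (u i $ a) * u i $ b))"
    unfolding sum_distrib_left by (rule sum.cong[OF refl], rule sum.swap)
  also have "\<dots> = (\<Sum>a<n. \<Sum>b<n. if b = a then v $ a * cnj (w $ b) else 0)"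
    by (intro sum.cong refl) (auto simp: u_complete)
  also have "\<dots> = v \<bullet>c w"
    unfolding cscalar_prod_sum[OF w] by (intro sum.cong refl) (simp add: sum.delta)
  finally show ?thesis by simp
qed

lemma norm2_coord:
  assumes w: "w \<in> carrier_vec n"
  shows "(norm2 w)\<^sup>2 = (\<Sum>i<n. (cmod (coord i w))\<^sup>2)"
proof -
  have "complex_of_real ((norm2 w)\<^sup>2) = w \<bullet>c w"
    using w by (simp add: norm2_def sum_nonneg cscalar_prod_sum[OF w] complex_norm_square[symmetric])
  also have "\<dots> = of_real (\<Sum>i<n. (cmod (coord i w))\<^sup>2)"
    by (simp add: parseval[OF w] complex_norm_square[symmetric])
  finally show ?thesis
    using of_real_eq_iff by blast
qed

text \<open>The eigenvectors diagonalise \<open>A\<close>. This later ties the eigenvalues listed by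
  the characteristic polynomial to those of the eigenbasis.\<close>

lemma char_poly_eigenbasis: "char_poly A = (\<Prod>i\<leftarrow>[0..<n]. [:- complex_of_real (\<mu> i), 1:])"
proof -
  define U where "U = mat n n (\<lambda>(a, i). u i $ a)"
  define V where "V = mat n n (\<lambda>(i, a). cnj (u i $ a))"
  define D where "D = mat n n (\<lambda>(i, j). if i = j then complex_of_real (\<mu> i) else 0)"
  have carrier: "U \<in> carrier_mat n n" "V \<in> carrier_mat n n" "D \<in> carrier_mat n n"
    by (auto simp: U_def V_def D_def)
  have VU: "V * U = 1\<^sub>m n"
  proof (rule eq_matI)
    fix i j assume "i < dim_row (1\<^sub>m n :: complex mat)" "j < dim_col (1\<^sub>m n :: complex mat)"
    then have ij: "i < n" "j < n" by auto
    then have "(V * U) $$ (i, j) = (\<Sum>a<n. u j $ a * cnj (u i $ a))"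
      by (simp add: U_def V_def scalar_prod_def atLeast0LessThan mult.commute)
    then show "(V * U) $$ (i, j) = 1\<^sub>m n $$ (i, j)"
      using u_orthonormal_sum[OF ij(2,1)] ij by simp
  qed (use carrier in auto)
  have UV: "U * V = 1\<^sub>m n"
    by (rule mat_mult_left_right_inverse[OF carrier(2,1) VU])
  have AU: "A * U = U * D"
  proof (rule eq_matI)
    fix a j assume "a < dim_row (U * D)" "j < dim_col (U * D)"
    then have aj: "a < n" "j < n" using carrier by auto
    have "col U j = u j"
      using u_carrier[OF aj(2)] aj by (intro eq_vecI) (auto simp: U_def)
    then have "(A * U) $$ (a, j) = (A *\<^sub>v u j) $ a"
      using aj A carrier by simp
    also have "\<dots> = of_real (\<mu> j) * u j $ a"
      using u_carrier[OF aj(2)] aj by (simp add: u_eigen[OF aj(2)])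
    also have "\<dots> = (\<Sum>k<n. if k = j then u k $ a * of_real (\<mu> k) else 0)"
      using aj by (simp add: sum.delta mult.commute)
    also have "\<dots> = (\<Sum>k<n. u k $ a * (if k = j then of_real (\<mu> k) else 0))"
      by (intro sum.cong) auto
    also have "\<dots> = (U * D) $$ (a, j)"
      using aj by (simp add: U_def D_def scalar_prod_def atLeast0LessThan)
    finally show "(A * U) $$ (a, j) = (U * D) $$ (a, j)" .
  qed (use A carrier in auto)
  have "A = A * (U * V)"
    using A by (simp add: UV)
  also have "\<dots> = U * D * V"
    using A carrier by (simp add: AU flip: assoc_mult_mat[of A n n U n V n])
  finally have "similar_mat A D"
    unfolding similar_mat_def similar_mat_wit_def using A carrier UV VU
    by (intro exI[of _ U] exI[of _ V]) (auto simp: Let_def)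
  then have "char_poly A = char_poly D"
    by (rule char_poly_similar)
  also have "\<dots> = (\<Prod>a\<leftarrow>diag_mat D. [:- a, 1:])"
    by (rule char_poly_upper_triangular[OF carrier(3)]) (auto simp: D_def)
  also have "diag_mat D = map (\<lambda>i. complex_of_real (\<mu> i)) [0..<n]"
    by (auto simp: diag_mat_def D_def)
  finally show ?thesis
    by (simp add: comp_def)
qed

end

lemma proots_linear_factors:
  fixes xs :: "'a :: idom list"
  shows "proots (\<Prod>x\<leftarrow>xs. [:- x, 1:]) = mset xs"
proof (induction xs)
  case (Cons x xs)
  have "proots [:- x, 1:] = {#x#}"
    by (rule multiset_eqI) (simp add: order_linear_power')
  moreover have "(\<Prod>x\<leftarrow>xs. [:- x, 1:]) \<noteq> 0"
    by (auto simp: prod_list_zero_iff)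
  ultimately show ?case
    using Cons by (simp add: proots_mult del: mult_pCons_left)
qed simp

section \<open>The Lanczos process as an orthogonalisation of polynomials\<close>

locale lanczos_start = orthonormal_eigenbasis +
  fixes v :: "complex Matrix.vec" and \<omega> :: "nat \<Rightarrow> complex"
  assumes v_def: "v = finsum_vec TYPE(complex) n (\<lambda>i. \<omega> i \<cdot>\<^sub>v u i) {..<n}"
    and weights: "i < n \<Longrightarrow> (cmod (\<omega> i))\<^sup>2 = 1 / real n"
    and n: "0 < n"
begin

lemma v_carrier: "v \<in> carrier_vec n"
  unfolding v_def by (rule finsum_vec_closed) (use u_carrier in auto)

lemma coord_v:
  assumes i: "i < n"
  shows "coord i v = \<omega> i"
proof -
  have "coord i v = (\<Sum>a<n. (\<Sum>k<n. \<omega> k * u k $ a) * cnj (u i $ a))"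
    unfolding coord_def v_def
  proof (rule sum.cong)
    fix a assume "a \<in> {..<n}"
    then have a: "a < n" by simp
    have "finsum_vec TYPE(complex) n (\<lambda>i. \<omega> i \<cdot>\<^sub>v u i) {..<n} $ a = (\<Sum>k<n. (\<omega> k \<cdot>\<^sub>v u k) $ a)"
      using u_carrier by (intro index_finsum_vec a) auto
    also have "\<dots> = (\<Sum>k<n. \<omega> k * u k $ a)"
    proof (rule sum.cong)
      fix k assume "k \<in> {..<n}"
      then have "u k \<in> carrier_vec n"
        by (simp add: u_carrier)
      then show "(\<omega> k \<cdot>\<^sub>v u k) $ a = \<omega> k * u k $ a"
        using a by simp
    qed simp
    finally show "finsum_vec TYPE(complex) n (\<lambda>i. \<omega> i \<cdot>\<^sub>v u i) {..<n} $ a * cnj (u i $ a)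
        = (\<Sum>k<n. \<omega> k * u k $ a) * cnj (u i $ a)"
      by simp
  qed simp
  also have "\<dots> = (\<Sum>a<n. \<Sum>k<n. \<omega> k * (u k $ a * cnj (u i $ a)))"
    by (simp add: sum_distrib_right mult.assoc)
  also have "\<dots> = (\<Sum>k<n. \<omega> k * (\<Sum>a<n. u k $ a * cnj (u i $ a)))"
    unfolding sum_distrib_left by (rule sum.swap)
  also have "\<dots> = (\<Sum>k<n. if k = i then \<omega> k else 0)"
    using i by (intro sum.cong refl) (auto simp: u_orthonormal_sum)
  finally show ?thesis
    using i by simp
qed

text \<open>The pairing of the spectral density with \<open>p\<close>. By the equal weights it is
  also the inner product of \<open>p(A) v\<close> with \<open>v\<close>, the functional that the
  process orthogonalises for.\<close>

definition spectral_mean :: "real poly \<Rightarrow> real" where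
  "spectral_mean p = (1 / real n) * (\<Sum>i<n. poly p (\<mu> i))"

sublocale poly_functional spectral_mean
  by unfold_locales (simp_all add: spectral_mean_def sum.distrib distrib_left sum_distrib_left mult_ac)

text \<open>In eigenvector coordinates a vector of the form \<open>p(A) v\<close> is \<open>i \<mapsto> \<omega> i * p(\<mu> i)\<close>.\<close>

definition represents :: "real poly \<Rightarrow> complex Matrix.vec \<Rightarrow> bool" where
  "represents p w \<longleftrightarrow> w \<in> carrier_vec n \<and> (\<forall>i<n. coord i w = \<omega> i * complex_of_real (poly p (\<mu> i)))"

lemma represents_diff: "represents p w \<Longrightarrow> represents p' w' \<Longrightarrow> represents (p - p') (w - w')"
  by (auto simp: represents_def coord_diff algebra_simps)

lemma represents_smult: "represents p w \<Longrightarrow> represents (Polynomial.smult c p) (complex_of_real c \<cdot>\<^sub>v w)"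
  by (auto simp: represents_def coord_smult)

lemma represents_mult_mat: "represents p w \<Longrightarrow> represents (pCons 0 p) (A *\<^sub>v w)"
  using A by (auto simp: represents_def coord_mult_mat)

text \<open>By \<open>parseval\<close>: the weights enter only through
  \<open>\<omega> i * cnj (\<omega> i) = 1 / n\<close>, and values of real polynomials are fixed by
  conjugation.\<close>

lemma represents_inner:
  assumes "represents p w" "represents p' w'"
  shows "w \<bullet>c w' = complex_of_real (spectral_mean (p * p'))"
proof -
  have "w \<bullet>c w' = (\<Sum>i<n. complex_of_real ((1 / real n) * poly (p * p') (\<mu> i)))"
    unfolding parseval[of w', OF assms(2)[unfolded represents_def, THEN conjunct1]]
  proof (rule sum.cong)
    fix i assume "i \<in> {..<n}"
    then have i: "i < n" by simp
    have "coord i w * cnj (coord i w') = (\<omega> i * cnj (\<omega> i)) * complex_of_real (poly p (\<mu> i) * poly p' (\<mu> i))"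
      using assms i by (simp add: represents_def)
    also have "\<omega> i * cnj (\<omega> i) = complex_of_real (1 / real n)"
      using weights[OF i] by (simp add: complex_norm_square[symmetric])
    finally show "coord i w * cnj (coord i w') = complex_of_real ((1 / real n) * poly (p * p') (\<mu> i))"
      by simp
  qed simp
  then show ?thesis
    by (simp add: spectral_mean_def sum_distrib_left)
qed

lemma represents_norm2:
  assumes "represents p w"
  shows "(norm2 w)\<^sup>2 = spectral_mean (p\<^sup>2)"
proof -
  have w: "w \<in> carrier_vec n" using assms by (simp add: represents_def)
  have "(norm2 w)\<^sup>2 = (\<Sum>i<n. (1 / real n) * poly (p\<^sup>2) (\<mu> i))"
    unfolding norm2_coord[OF w] using assms
    by (intro sum.cong refl) (auto simp: represents_def norm_mult power_mult_distrib weights)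
  then show ?thesis
    by (simp add: spectral_mean_def sum_distrib_left)
qed

abbreviation "\<alpha> j \<equiv> Re (lanczos_alpha A v j)"
abbreviation "\<beta> \<equiv> lanczos_beta A v"

definition step_vec :: "nat \<Rightarrow> complex Matrix.vec" where
  "step_vec j = A *\<^sub>v lanczos_vec A v j - complex_of_real (\<beta> j) \<cdot>\<^sub>v lanczos_vec A v (j - 1)"

lemma lanczos_alpha_eq: "lanczos_alpha A v j = step_vec j \<bullet>c lanczos_vec A v j"
  by (simp add: lanczos_alpha_def step_vec_def)

lemma lanczos_beta_Suc:
  "1 \<le> j \<Longrightarrow> \<beta> (Suc j) = norm2 (step_vec j - lanczos_alpha A v j \<cdot>\<^sub>v lanczos_vec A v j)"
  unfolding lanczos_alpha_eq
  by (cases j) (simp_all add: step_vec_def lanczos_beta_def lanczos_vec_def Let_def)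

lemma lanczos_vec_Suc:
  assumes "1 \<le> j"
  shows "lanczos_vec A v (Suc j) = complex_of_real (1 / \<beta> (Suc j)) \<cdot>\<^sub>v (step_vec j - lanczos_alpha A v j \<cdot>\<^sub>v lanczos_vec A v j)"
  unfolding lanczos_beta_Suc[OF assms] unfolding lanczos_alpha_eq using assms
  by (cases j) (simp_all add: step_vec_def lanczos_beta_def lanczos_vec_def Let_def)

lemma represents_step:
  assumes "represents (lanczos_poly \<alpha> \<beta> j) (lanczos_vec A v j)"
    "represents (lanczos_poly \<alpha> \<beta> (j - 1)) (lanczos_vec A v (j - 1))"
  shows "represents (pCons 0 (lanczos_poly \<alpha> \<beta> j) - Polynomial.smult (\<beta> j) (lanczos_poly \<alpha> \<beta> (j - 1))) (step_vec j)"
  unfolding step_vec_def by (intro represents_diff represents_smult represents_mult_mat assms)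

text \<open>Inner products of represented vectors are real, so \<open>Re\<close> loses nothing and
  the complex vector recursion matches the real polynomial one.\<close>

lemma lanczos_alpha_real:
  assumes "represents (lanczos_poly \<alpha> \<beta> j) (lanczos_vec A v j)"
    "represents (lanczos_poly \<alpha> \<beta> (j - 1)) (lanczos_vec A v (j - 1))"
  shows "lanczos_alpha A v j = complex_of_real (\<alpha> j)"
  using trans[OF lanczos_alpha_eq represents_inner[OF represents_step[OF assms] assms(1)]]
  by (metis Re_complex_of_real)

lemma represents_residual:
  assumes "represents (lanczos_poly \<alpha> \<beta> j) (lanczos_vec A v j)"
    "represents (lanczos_poly \<alpha> \<beta> (j - 1)) (lanczos_vec A v (j - 1))"
  shows "represents (lanczos_residual \<alpha> \<beta> j) (step_vec j - lanczos_alpha A v j \<cdot>\<^sub>v lanczos_vec A v j)"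
proof -
  have "lanczos_residual \<alpha> \<beta> j = (pCons 0 (lanczos_poly \<alpha> \<beta> j) - Polynomial.smult (\<beta> j) (lanczos_poly \<alpha> \<beta> (j - 1)))
      - Polynomial.smult (\<alpha> j) (lanczos_poly \<alpha> \<beta> j)"
    by (simp add: lanczos_residual_def)
  moreover have "step_vec j - lanczos_alpha A v j \<cdot>\<^sub>v lanczos_vec A v j
      = step_vec j - complex_of_real (\<alpha> j) \<cdot>\<^sub>v lanczos_vec A v j"
    by (rule arg_cong[OF lanczos_alpha_real[OF assms]])
  ultimately show ?thesis
    using represents_diff[OF represents_step[OF assms] represents_smult[OF assms(1)]] by (simp only:)
qed

text \<open>Both recursions divide by the same \<beta>, with \<open>1 / 0 = 0\<close>, so they stay
  in step for every \<open>j\<close>, even past a breakdown.\<close>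

lemma represents_lanczos:
  "represents (lanczos_poly \<alpha> \<beta> j) (lanczos_vec A v j)"
proof (induction j rule: less_induct)
  case (less j)
  consider "j = 0" | "j = 1" | i where "j = Suc i" "1 \<le> i"
    by (metis One_nat_def Suc_leI neq0_conv not0_implies_Suc)
  then show ?case
  proof cases
    case 1
    then show ?thesis
      using v_carrier by (simp add: represents_def lanczos_vec_def coord_def)
  next
    case 2
    then show ?thesis
      using v_carrier by (simp add: represents_def lanczos_vec_def coord_v)
  next
    case 3
    then show ?thesis
      unfolding 3(1) lanczos_poly_Suc[OF 3(2)] lanczos_vec_Suc[OF 3(2)]
      by (intro represents_smult represents_residual less.IH) (use 3(1) in auto)
  qed
qed

lemma lanczos_functional:
  assumes m: "1 \<le> m" and runs: "lanczos_runs A v m"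
  shows "lanczos_functional spectral_mean \<alpha> \<beta> m"
proof
  show "spectral_mean 1 = 1"
    using n by (simp add: spectral_mean_def)
  show "\<beta> 1 = 0"
    by (simp add: lanczos_beta_def)
  show "\<beta> j \<noteq> 0" if "2 \<le> j" "j \<le> m" for j
    using runs that by (auto simp: lanczos_runs_def)
  show "\<alpha> j = spectral_mean ((pCons 0 (lanczos_poly \<alpha> \<beta> j) - Polynomial.smult (\<beta> j) (lanczos_poly \<alpha> \<beta> (j - 1)))
      * lanczos_poly \<alpha> \<beta> j)" for j
  proof -
    have "lanczos_alpha A v j = complex_of_real (spectral_mean
        ((pCons 0 (lanczos_poly \<alpha> \<beta> j) - Polynomial.smult (\<beta> j) (lanczos_poly \<alpha> \<beta> (j - 1))) * lanczos_poly \<alpha> \<beta> j))"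
      by (rule trans[OF lanczos_alpha_eq
            represents_inner[OF represents_step[OF represents_lanczos represents_lanczos] represents_lanczos]])
    then show ?thesis
      by (metis Re_complex_of_real)
  qed
  show "(\<beta> (Suc j))\<^sup>2 = spectral_mean ((lanczos_residual \<alpha> \<beta> j)\<^sup>2)" if "1 \<le> j" for j
    unfolding lanczos_beta_Suc[OF that]
    by (rule represents_norm2[OF represents_residual[OF represents_lanczos represents_lanczos]])
qed (rule m)

end

section \<open>The error of the Lanczos density\<close>

lemma (in lanczos_start) mset_eigenvalues:
  assumes "char_poly A = (\<Prod>l\<leftarrow>ls. [:- complex_of_real l, 1:])"
  shows "mset ls = mset (map \<mu> [0..<n])"
proof -
  have "(\<Prod>x\<leftarrow>map complex_of_real ls. [:- x, 1:]) = (\<Prod>x\<leftarrow>map complex_of_real (map \<mu> [0..<n]). [:- x, 1:])"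
    using assms char_poly_eigenbasis by (simp add: comp_def)
  then have "mset (map complex_of_real ls) = mset (map complex_of_real (map \<mu> [0..<n]))"
    by (metis proots_linear_factors)
  then have "image_mset complex_of_real (mset ls) = image_mset complex_of_real (mset (map \<mu> [0..<n]))"
    by (simp only: mset_map)
  then show ?thesis
    by (rule injD[OF multiset.inj_map[OF inj_of_real]])
qed

lemma (in lanczos_start) spectral_density_eq:
  assumes "char_poly A = (\<Prod>l\<leftarrow>ls. [:- complex_of_real l, 1:])" "length ls = n"
  shows "spectral_density ls g = (1 / of_nat n) * (\<Sum>i<n. g (\<mu> i))"
proof -
  have "(\<Sum>l\<leftarrow>ls. g l) = sum_mset (image_mset g (mset ls))"
    by (simp only: sum_mset_sum_list mset_map[symmetric])
  also have "\<dots> = sum_mset (mset (map g (map \<mu> [0..<n])))"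
    by (simp only: mset_eigenvalues[OF assms(1)] mset_map)
  also have "\<dots> = (\<Sum>i\<leftarrow>[0..<n]. g (\<mu> i))"
    by (simp only: sum_mset_sum_list map_map comp_def)
  also have "\<dots> = (\<Sum>i<n. g (\<mu> i))"
    by (simp add: interv_sum_list_conv_sum_set_nat atLeast0LessThan)
  finally show ?thesis
    using assms(2) by (simp add: spectral_density_def dirac_def)
qed

text \<open>Both functionals are averages with nonnegative weights of sum 1. Replacing
  \<open>g\<close> by \<open>p\<close> costs each at most \<epsilon>, and on \<open>p\<close> they
  agree.\<close>

lemma quadrature_error:
  fixes a \<mu> \<theta> :: "nat \<Rightarrow> real" and g :: "real \<Rightarrow> complex"
  assumes n: "0 < n" and m: "1 \<le> m"
    and exact: "\<And>k. k < 2 * m \<Longrightarrow> (\<Sum>l<m. a l * \<theta> l ^ k) = (1 / real n) * (\<Sum>i<n. \<mu> i ^ k)"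
    and a: "\<And>l. l < m \<Longrightarrow> 0 \<le> a l"
    and \<mu>: "\<And>i. i < n \<Longrightarrow> \<mu> i \<in> {-1..1}" and \<theta>: "\<And>l. l < m \<Longrightarrow> \<theta> l \<in> {-1..1}"
    and p: "degree p < 2 * m"
    and g: "\<And>x. x \<in> {-1..1} \<Longrightarrow> cmod (g x - poly p (complex_of_real x)) \<le> \<epsilon>"
  shows "cmod ((1 / of_nat n) * (\<Sum>i<n. g (\<mu> i)) - (\<Sum>l<m. complex_of_real (a l) * g (\<theta> l))) \<le> 2 * \<epsilon>"
proof -
  let ?p = "\<lambda>x. poly p (complex_of_real x)"
  have poly_exact: "(\<Sum>l<m. complex_of_real (a l) * ?p (\<theta> l)) = (1 / of_nat n) * (\<Sum>i<n. ?p (\<mu> i))"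
  proof -
    have "(\<Sum>l<m. complex_of_real (a l) * ?p (\<theta> l)) = (\<Sum>l<m. \<Sum>k\<le>degree p. coeff p k * complex_of_real (a l * \<theta> l ^ k))"
      by (simp add: poly_altdef sum_distrib_left mult_ac)
    also have "\<dots> = (\<Sum>k\<le>degree p. coeff p k * complex_of_real (\<Sum>l<m. a l * \<theta> l ^ k))"
      unfolding of_real_sum sum_distrib_left by (rule sum.swap)
    also have "\<dots> = (\<Sum>k\<le>degree p. coeff p k * complex_of_real ((1 / real n) * (\<Sum>i<n. \<mu> i ^ k)))"
      using p by (intro sum.cong refl) (simp only: exact atMost_iff)
    also have "\<dots> = (\<Sum>k\<le>degree p. \<Sum>i<n. (1 / of_nat n) * (coeff p k * complex_of_real (\<mu> i) ^ k))"
      by (simp add: sum_distrib_left sum_divide_distrib)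
    also have "\<dots> = (\<Sum>i<n. \<Sum>k\<le>degree p. (1 / of_nat n) * (coeff p k * complex_of_real (\<mu> i) ^ k))"
      by (rule sum.swap)
    also have "\<dots> = (1 / of_nat n) * (\<Sum>i<n. ?p (\<mu> i))"
      by (simp only: poly_altdef sum_distrib_left)
    finally show ?thesis .
  qed
  have a1: "(\<Sum>l<m. a l) = 1"
    using exact[of 0] n m by simp
  have "(1 / of_nat n) * (\<Sum>i<n. g (\<mu> i)) - (\<Sum>l<m. complex_of_real (a l) * g (\<theta> l))
      = (\<Sum>i<n. (1 / of_nat n) * (g (\<mu> i) - ?p (\<mu> i))) - (\<Sum>l<m. complex_of_real (a l) * (g (\<theta> l) - ?p (\<theta> l)))"
    using poly_exact by (simp only: right_diff_distrib sum_subtractf sum_distrib_left) simp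
  also have "cmod \<dots> \<le> (\<Sum>i<n. (1 / real n) * \<epsilon>) + (\<Sum>l<m. a l * \<epsilon>)"
  proof (intro order.trans[OF norm_triangle_ineq4] add_mono sum_norm_le)
    fix i assume "i \<in> {..<n}"
    then show "cmod ((1 / of_nat n) * (g (\<mu> i) - ?p (\<mu> i))) \<le> (1 / real n) * \<epsilon>"
      using g[OF \<mu>[of i]] by (simp add: norm_mult norm_divide divide_right_mono)
  next
    fix l assume "l \<in> {..<m}"
    then show "cmod (complex_of_real (a l) * (g (\<theta> l) - ?p (\<theta> l))) \<le> a l * \<epsilon>"
      using g[OF \<theta>[of l]] a[of l] by (simp add: norm_mult mult_left_mono)
  qed
  also have "\<dots> = 2 * \<epsilon>"
    using n a1 by (simp flip: sum_distrib_right)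
  finally show ?thesis .
qed

lemma lanczos_error:
  assumes A: "A \<in> carrier_mat n n" "hermitian A" "spectrum A \<subseteq> complex_of_real ` {-1..1}"
    and ls: "length ls = n" "char_poly A = (\<Prod>l\<leftarrow>ls. [:- complex_of_real l, 1:])"
    and v: "v \<in> carrier_vec n" "norm2 v = 1" "equal_weights n A v"
    and m: "m \<ge> 1" "lanczos_runs A v m" "orthonormal_eigensystem m (lanczos_matrix A v m) \<theta> y"
    and p: "degree p < 2 * m"
    and g: "\<And>x. x \<in> {-1..1} \<Longrightarrow> cmod (g x - poly p (complex_of_real x)) \<le> \<epsilon>"
  shows "cmod (spectral_density ls g - lanczos_density m \<theta> y g) \<le> 2 * \<epsilon>"
proof -
  \<comment> \<open>In dimension 0 the norm would be 0.\<close>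
  have n: "0 < n"
    using v(1,2) by (cases n) (auto simp: norm2_def)
  obtain u \<omega> where u: "\<And>i. i < n \<Longrightarrow> u i \<in> carrier_vec n" "\<And>i. i < n \<Longrightarrow> \<exists>\<mu>. eigenvector A (u i) \<mu>"
    "\<And>i j. i < n \<Longrightarrow> j < n \<Longrightarrow> u i \<bullet>c u j = (if i = j then 1 else 0)"
    "v = finsum_vec TYPE(complex) n (\<lambda>i. \<omega> i \<cdot>\<^sub>v u i) {..<n}"
    "\<And>i. i < n \<Longrightarrow> (cmod (\<omega> i))\<^sup>2 = 1 / real n"
    using v(3) unfolding equal_weights_def by blast
  have "\<exists>\<mu>. \<mu> \<in> {-1..1} \<and> eigenvector A (u i) (complex_of_real \<mu>)" if i: "i < n" for i
  proof -
    obtain z where z: "eigenvector A (u i) z"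
      using u(2)[OF i] by blast
    then have "z \<in> spectrum A"
      by (auto simp: spectrum_def eigenvalue_def)
    then show ?thesis
      using A(3) z by blast
  qed
  then obtain \<mu> where \<mu>: "\<And>i. i < n \<Longrightarrow> \<mu> i \<in> {-1..1}"
    "\<And>i. i < n \<Longrightarrow> eigenvector A (u i) (complex_of_real (\<mu> i))"
    by metis
  interpret lanczos_start n A u \<mu> v \<omega>
    by unfold_locales (use A u \<mu>(2) n in \<open>auto simp: eigenvector_def\<close>)
  interpret F: lanczos_functional spectral_mean \<alpha> \<beta> m
    by (rule lanczos_functional[OF m(1,2)])
  interpret R: lanczos_ritz spectral_mean \<alpha> \<beta> m "lanczos_matrix A v m" \<theta> y
    by unfold_locales (use m(3) in \<open>simp_all add: lanczos_matrix_def\<close>)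
  \<comment> \<open>All \<open>\<mu> i\<close> are bounded by 1, hence so are Rayleigh quotients and
    with them the Ritz values; \<open>g\<close> is thus well approximated at the nodes too.\<close>
  have mean_abs: "\<bar>spectral_mean (pCons 0 (q\<^sup>2))\<bar> \<le> spectral_mean (q\<^sup>2)" for q
  proof -
    have "\<bar>\<Sum>i<n. poly (pCons 0 (q\<^sup>2)) (\<mu> i)\<bar> \<le> (\<Sum>i<n. poly (q\<^sup>2) (\<mu> i))"
    proof (rule order.trans[OF sum_abs], rule sum_mono)
      fix i assume "i \<in> {..<n}"
      then have "\<bar>\<mu> i\<bar> \<le> 1"
        using \<mu>(1)[of i] by auto
      then show "\<bar>poly (pCons 0 (q\<^sup>2)) (\<mu> i)\<bar> \<le> poly (q\<^sup>2) (\<mu> i)"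
        by (simp add: abs_mult mult_left_le_one_le)
    qed
    then show ?thesis
      by (simp add: spectral_mean_def abs_mult divide_right_mono)
  qed
  have \<theta>: "\<theta> l \<in> {-1..1}" if "l < m" for l
  proof -
    obtain q where "spectral_mean (q\<^sup>2) = 1" "spectral_mean (pCons 0 (q\<^sup>2)) = \<theta> l"
      using R.ritz_value_rayleigh[OF \<open>l < m\<close>] by metis
    then show ?thesis
      using mean_abs[of q] by auto
  qed
  have exact: "(\<Sum>l<m. (y l $ 0)\<^sup>2 * \<theta> l ^ k) = (1 / real n) * (\<Sum>i<n. \<mu> i ^ k)" if "k < 2 * m" for k
    using R.quadrature_exact[of "monom 1 k"] that
    by (simp add: spectral_mean_def poly_monom degree_monom_eq)
  have "lanczos_density m \<theta> y g = (\<Sum>l<m. complex_of_real ((y l $ 0)\<^sup>2) * g (\<theta> l))"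
    unfolding lanczos_density_def dirac_def
    using R.y_carrier m(1) by (intro sum.cong refl) (auto simp: scalar_prod_left_unit)
  then show ?thesis
    unfolding spectral_density_eq[OF ls(2,1)]
    using quadrature_error[OF n m(1) exact _ \<mu>(1) \<theta> p g] by simp
qed

theorem theorem4p1:
  fixes g :: "real \<Rightarrow> complex"
  assumes "real_analytic_on g {-1..1}"
  shows "\<exists>(\<rho> :: real) (M :: real). \<rho> > 1 \<and>
    (\<forall>(n :: nat) (A :: complex mat) (ls :: real list) (v :: real Matrix.vec) (m :: nat)
       (\<theta> :: nat \<Rightarrow> real) (y :: nat \<Rightarrow> real Matrix.vec).
      A \<in> carrier_mat n n \<longrightarrow> hermitian A \<longrightarrow>
      spectrum A \<subseteq> complex_of_real ` {-1..1} \<longrightarrow>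
      length ls = n \<longrightarrow> sorted ls \<longrightarrow>
      char_poly A = (\<Prod>l\<leftarrow>ls. [:- complex_of_real l, 1:]) \<longrightarrow>
      v \<in> carrier_vec n \<longrightarrow>
      norm2 (map_vec complex_of_real v) = 1 \<longrightarrow>
      equal_weights n A (map_vec complex_of_real v) \<longrightarrow>
      m \<ge> 1 \<longrightarrow> lanczos_runs A (map_vec complex_of_real v) m \<longrightarrow>
      orthonormal_eigensystem m (lanczos_matrix A (map_vec complex_of_real v) m) \<theta> y \<longrightarrow>
      cmod (spectral_density ls g - lanczos_density m \<theta> y g)
        \<le> 4 * \<rho>\<^sup>2 * M / ((\<rho>\<^sup>2 - 1) * \<rho> ^ (2 * m)))"
proof -
  obtain L :: nat and C K q where q: "0 \<le> q" "q < 1" and C: "0 \<le> C"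
    and approx: "\<And>N. \<exists>p. degree p \<le> L * N \<and>
         (\<forall>x\<in>{-1..1}. cmod (poly p (complex_of_real x)) \<le> C * K ^ N) \<and>
         (\<forall>x\<in>{-1..1}. cmod (g x - poly p (complex_of_real x)) \<le> C * q ^ N)"
    using geometric_approx_real_analytic[OF assms] unfolding geometric_approx_def by blast
  \<comment> \<open>Keeps \<open>1 / q'\<close> meaningful when \<open>q = 0\<close>; likewise
    \<open>d\<close> below is positive even if \<open>L = 0\<close>.\<close>
  define q' where "q' = max q (1 / 2)"
  have q': "q \<le> q'" "0 < q'" "q' < 1"
    using q by (auto simp: q'_def)
  define d where "d = Suc L"
  \<comment> \<open>Each increment of \<open>N\<close> uses up at most \<open>d\<close> degrees, so
    a decay by \<open>q'\<close> per increment is a decay by \<open>1 / \<rho>\<close> per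
    degree.\<close>
  define \<rho> where "\<rho> = root d (1 / q')"
  have \<rho>: "1 < \<rho>" "\<rho> ^ d = 1 / q'"
    using q' real_root_pow_pos2[of d "1 / q'"] by (auto simp: \<rho>_def d_def real_root_gt_1_iff simp del: power_Suc)
  \<comment> \<open>Solves the equation between the claimed bound and
    \<open>2 * C * \<rho> ^ d / \<rho> ^ (2 * m)\<close>.\<close>
  define M where "M = 2 * C * \<rho> ^ d * (\<rho>\<^sup>2 - 1) / (4 * \<rho>\<^sup>2)"
  have error: "cmod (spectral_density ls g - lanczos_density m \<theta> y g)
        \<le> 4 * \<rho>\<^sup>2 * M / ((\<rho>\<^sup>2 - 1) * \<rho> ^ (2 * m))"
    if A: "A \<in> carrier_mat n n" "hermitian A" "spectrum A \<subseteq> complex_of_real ` {-1..1}"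
    and ls: "length ls = n" "char_poly A = (\<Prod>l\<leftarrow>ls. [:- complex_of_real l, 1:])"
    and v: "v \<in> carrier_vec n" "norm2 v = 1" "equal_weights n A v"
    and m: "m \<ge> 1" "lanczos_runs A v m" "orthonormal_eigensystem m (lanczos_matrix A v m) \<theta> y"
  for n A ls v m \<theta> y
  proof -
    \<comment> \<open>The largest \<open>N\<close> with \<open>d * N \<le> 2 * m - 1\<close>, the
      degree of exactness; rounding down costs the factor \<open>\<rho> ^ d\<close> in
      \<open>M\<close>.\<close>
    define N where "N = (2 * m - 1) div d"
    have N: "d * N < 2 * m" "2 * m \<le> d * N + d"
    proof -
      have "d * N \<le> 2 * m - 1"
        unfolding N_def by (rule times_div_less_eq_dividend)
      then show "d * N < 2 * m"
        using m(1) by linarith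
      have "2 * m - 1 < d * N + d"
        unfolding N_def using dividend_less_times_div[of d "2 * m - 1"] by (simp add: d_def)
      then show "2 * m \<le> d * N + d"
        by linarith
    qed
    obtain p where p: "degree p \<le> L * N" "\<And>x. x \<in> {-1..1} \<Longrightarrow> cmod (g x - poly p (complex_of_real x)) \<le> C * q ^ N"
      using approx[of N] by blast
    have "L * N \<le> d * N"
      by (simp add: d_def)
    then have deg: "degree p < 2 * m"
      using p(1) N(1) by linarith
    have "\<rho> ^ (2 * m) \<le> \<rho> ^ (d * N + d)"
      using N(2) \<rho>(1) by (intro power_increasing) auto
    then have "q' ^ N * \<rho> ^ (2 * m) \<le> q' ^ N * \<rho> ^ (d * N + d)"
      using q' by simp
    also have "\<dots> = \<rho> ^ d"
      using q' by (simp add: power_add power_mult \<rho>(2) power_divide)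
    finally have "q' ^ N \<le> \<rho> ^ d / \<rho> ^ (2 * m)"
      using \<rho>(1) by (simp add: pos_le_divide_eq)
    then have "C * q ^ N \<le> C * (\<rho> ^ d / \<rho> ^ (2 * m))"
      using power_mono[OF q'(1) q(1), of N] C by (intro mult_left_mono) auto
    moreover have "cmod (spectral_density ls g - lanczos_density m \<theta> y g) \<le> 2 * (C * q ^ N)"
      by (rule lanczos_error[OF A ls v m deg p(2)])
    ultimately have "cmod (spectral_density ls g - lanczos_density m \<theta> y g) \<le> 2 * C * \<rho> ^ d / \<rho> ^ (2 * m)"
      by simp
    also have "\<dots> = 4 * \<rho>\<^sup>2 * M / ((\<rho>\<^sup>2 - 1) * \<rho> ^ (2 * m))"
    proof -
      have "\<rho>\<^sup>2 - 1 > 0" "\<rho>\<^sup>2 \<noteq> 0"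
        using \<rho>(1) by (auto simp: power2_eq_square intro: less_1_mult)
      then show ?thesis
        by (simp add: M_def)
    qed
    finally show ?thesis .
  qed
  have carrier: "map_vec complex_of_real v \<in> carrier_vec n" if "v \<in> carrier_vec n" for v n
    using that by simp
  show ?thesis
    using \<rho>(1) by (intro exI[of _ \<rho>] exI[of _ M] conjI allI impI error[OF _ _ _ _ _ carrier]) auto
qed

end
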